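(* Let $\widetilde A=(A,\tau_A,(A_i)_{i\ge0})$ be an orthogonal filtration of a unital $C^*$-algebra $A$. Let $\Gamma$ be a finitely generated discrete group, with a proper length function $l:\Gamma\to\mathbb N_0$, having an action $\beta$ on $A$ such that $\tau_A(\beta_g(a))=\tau_A(a)$ for all $a\in A$ and $g\in\Gamma$. For $i,j\ge0$ put $A_{ij}=\mathrm{span}\{a\lambda_g: a\in A_i,\ g\in\Gamma,\ l(g)=j\}\subseteq A\rtimes_{\beta,r}\Gamma$. Then the triplet $(A\rtimes_{\beta,r}\Gamma,\ \tau,\ (A_{ij})_{i,j\ge0})$ is an orthogonal filtration of the $C^*$-algebra $A\rtimes_{\beta,r}\Gamma$, where $\tau=\tau_A\circ\tau'$ and $\tau':A\rtimes_{\beta,r}\Gamma\to A$ is the canonical conditional expectation.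
   Context: An orthogonal filtration of a unital $C^*$-algebra $A$ with a faithful state $\tau_A$ is a family of finite-dimensional subspaces $A_i$ (indexed by $i\in\mathbb N_0$, or by another countable index set such as pairs $(i,j)$ with $(0,0)$ playing the role of $0$) such that $A_0=\mathbb C1_A$, $\mathrm{span}\bigcup_iA_i$ is dense in $A$, and $\tau_A(a^*b)=0$ whenever $a\in A_i$, $b\in A_j$, $i\neq j$. A length function satisfies $l(g)=0\iff g=e$, $l(g^{-1})=l(g)$, $l(gh)\le l(g)+l(h)$; it is proper if each set $\{g:l(g)=n\}$ is finite. $A\rtimes_{\beta,r}\Gamma$ is the reduced crossed product, generated by $A$ and unitaries $\lambda_g$ with $\lambda_ga\lambda_g^*=\beta_g(a)$, and $\tau'(\sum_ga_g\lambda_g)=a_e$. *)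

theory Defs
  imports "HOL-Analysis.Analysis" "HOL-Algebra.Generated_Groups"
begin

section \<open>Unital C*-algebras\<close>

text \<open>
  The norm, the completeness and the real algebra structure come from the library classes; the
  scalar multiplication by complex numbers extends the real one. The library class
  \<^class>\<open>real_normed_algebra_1\<close> includes \<^term>\<open>norm 1 = 1\<close>, so the zero algebra, which carries no
  state, is excluded.
\<close>

class unital_cstar_algebra = real_normed_algebra_1 + banach +
  fixes scaleC :: "complex \<Rightarrow> 'a \<Rightarrow> 'a" (infixr \<open>*\<^sub>C\<close> 75)
    and star :: "'a \<Rightarrow> 'a"
  assumes scaleC_add_right: "c *\<^sub>C (x + y) = c *\<^sub>C x + c *\<^sub>C y"
    and scaleC_add_left: "(c + d) *\<^sub>C x = c *\<^sub>C x + d *\<^sub>C x"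
    and scaleC_scaleC: "c *\<^sub>C (d *\<^sub>C x) = (c * d) *\<^sub>C x"
    and scaleC_of_real: "complex_of_real r *\<^sub>C x = r *\<^sub>R x"
    and norm_scaleC: "norm (c *\<^sub>C x) = cmod c * norm x"
    and mult_scaleC_left: "(c *\<^sub>C x) * y = c *\<^sub>C (x * y)"
    and mult_scaleC_right: "x * (c *\<^sub>C y) = c *\<^sub>C (x * y)"
    and star_star: "star (star x) = x"
    and star_add: "star (x + y) = star x + star y"
    and star_scaleC: "star (c *\<^sub>C x) = cnj c *\<^sub>C star x"
    and star_mult: "star (x * y) = star y * star x"
    and cstar_identity: "norm (star x * x) = (norm x)\<^sup>2"

global_interpretation cvec: vector_space "scaleC :: complex \<Rightarrow> 'a \<Rightarrow> 'a::unital_cstar_algebra"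
  defines cspan = cvec.span
proof
  show "1 *\<^sub>C x = x" for x :: 'a
    using scaleC_of_real[of 1 x] by simp
qed (simp_all add: scaleC_add_right scaleC_add_left scaleC_scaleC)

definition star_hom :: "('a::unital_cstar_algebra \<Rightarrow> 'b::unital_cstar_algebra) \<Rightarrow> bool" where
  "star_hom f \<longleftrightarrow> Vector_Spaces.linear scaleC scaleC f \<and> f 1 = 1 \<and>
     (\<forall>x y. f (x * y) = f x * f y) \<and> (\<forall>x. f (star x) = star (f x))"

definition unitary :: "'a::unital_cstar_algebra \<Rightarrow> bool" where
  "unitary u \<longleftrightarrow> star u * u = 1 \<and> u * star u = 1"

definition faithful_state :: "('a::unital_cstar_algebra \<Rightarrow> complex) \<Rightarrow> bool" where
  "faithful_state \<tau> \<longleftrightarrow> Vector_Spaces.linear scaleC (*) \<tau> \<and> \<tau> 1 = 1 \<and>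
     (\<forall>a. \<tau> (star a * a) \<in> \<real>\<^sub>\<ge>\<^sub>0) \<and> (\<forall>a. \<tau> (star a * a) = 0 \<longrightarrow> a = 0)"


section \<open>Orthogonal filtrations\<close>

text \<open>
  The algebra is the whole type; the filtration \<open>V\<close> is indexed by a countable type in which
  \<open>i\<^sub>0\<close> plays the role of the index \<open>0\<close>.
\<close>

definition orthogonal_filtration ::
    "('a::unital_cstar_algebra \<Rightarrow> complex) \<Rightarrow> 'i::countable \<Rightarrow> ('i \<Rightarrow> 'a set) \<Rightarrow> bool" where
  "orthogonal_filtration \<tau> i\<^sub>0 V \<longleftrightarrow>
     faithful_state \<tau> \<and>
     (\<forall>i. \<exists>F. finite F \<and> V i = cspan F) \<and>
     V i\<^sub>0 = range (\<lambda>c. c *\<^sub>C 1) \<and>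
     closure (cspan (\<Union>i. V i)) = UNIV \<and>
     (\<forall>i j. i \<noteq> j \<longrightarrow> (\<forall>a\<in>V i. \<forall>b\<in>V j. \<tau> (star a * b) = 0))"


section \<open>Groups with a length function and their actions\<close>

definition finitely_generated :: "('g, 'm) monoid_scheme \<Rightarrow> bool" where
  "finitely_generated G \<longleftrightarrow> (\<exists>S. finite S \<and> S \<subseteq> carrier G \<and> generate G S = carrier G)"

definition proper_length :: "('g, 'm) monoid_scheme \<Rightarrow> ('g \<Rightarrow> nat) \<Rightarrow> bool" where
  "proper_length G l \<longleftrightarrow>
     (\<forall>g\<in>carrier G. l g = 0 \<longleftrightarrow> g = \<one>\<^bsub>G\<^esub>) \<and>
     (\<forall>g\<in>carrier G. l (inv\<^bsub>G\<^esub> g) = l g) \<and>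
     (\<forall>g\<in>carrier G. \<forall>h\<in>carrier G. l (g \<otimes>\<^bsub>G\<^esub> h) \<le> l g + l h) \<and>
     (\<forall>n. finite {g \<in> carrier G. l g = n})"

definition cstar_action ::
    "('g, 'm) monoid_scheme \<Rightarrow> ('g \<Rightarrow> 'a::unital_cstar_algebra \<Rightarrow> 'a) \<Rightarrow> bool" where
  "cstar_action G \<beta> \<longleftrightarrow>
     (\<forall>g\<in>carrier G. star_hom (\<beta> g) \<and> bij (\<beta> g)) \<and>
     (\<forall>g\<in>carrier G. \<forall>h\<in>carrier G. \<beta> (g \<otimes>\<^bsub>G\<^esub> h) = \<beta> g \<circ> \<beta> h)"


section \<open>The reduced crossed product\<close>

text \<open>
  Finitely supported functions from the group to the algebra serve both as elements
  \<open>\<Sum>\<^sub>g f(g) \<lambda>\<^sub>g\<close> of the algebraic crossed product and as vectors of the dense submodule of the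
  Hilbert module \<open>\<ell>\<^sup>2(G, A)\<close>, whose inner product is \<open>\<langle>\<xi>, \<eta>\<rangle> = \<Sum>\<^sub>g \<xi>(g)\<^sup>* \<eta>(g)\<close>.
  Values outside the carrier of the group are irrelevant.
\<close>

definition gsupp :: "('g, 'm) monoid_scheme \<Rightarrow> ('g \<Rightarrow> 'a::zero) \<Rightarrow> 'g set" where
  "gsupp G f = {g \<in> carrier G. f g \<noteq> 0}"

definition l2_norm ::
    "('g, 'm) monoid_scheme \<Rightarrow> ('g \<Rightarrow> 'a::unital_cstar_algebra) \<Rightarrow> real" where
  "l2_norm G \<xi> = sqrt (norm (\<Sum>g\<in>gsupp G \<xi>. star (\<xi> g) * \<xi> g))"

text \<open>
  The regular representation is given by \<open>(\<pi>(a) \<xi>)(g) = \<beta>\<^bsub>g\<^sup>-\<^sup>1\<^esub>(a) \<xi>(g)\<close> and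
  \<open>(\<lambda>\<^sub>h \<xi>)(g) = \<xi>(h\<^sup>-\<^sup>1 g)\<close>; the following is the action of \<open>\<Sum>\<^sub>h \<pi>(f(h)) \<lambda>\<^sub>h\<close>.
\<close>

definition regular_rep ::
    "('g, 'm) monoid_scheme \<Rightarrow> ('g \<Rightarrow> 'a::unital_cstar_algebra \<Rightarrow> 'a) \<Rightarrow>
     ('g \<Rightarrow> 'a) \<Rightarrow> ('g \<Rightarrow> 'a) \<Rightarrow> 'g \<Rightarrow> 'a" where
  "regular_rep G \<beta> f \<xi> g =
     (\<Sum>h\<in>gsupp G f. \<beta> (inv\<^bsub>G\<^esub> g) (f h) * \<xi> (inv\<^bsub>G\<^esub> h \<otimes>\<^bsub>G\<^esub> g))"

text \<open>The operator norm on \<open>\<ell>\<^sup>2(G, A)\<close>, computed on the dense submodule of finitely supported vectors.\<close>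

definition reduced_norm ::
    "('g, 'm) monoid_scheme \<Rightarrow> ('g \<Rightarrow> 'a::unital_cstar_algebra \<Rightarrow> 'a) \<Rightarrow> ('g \<Rightarrow> 'a) \<Rightarrow> real" where
  "reduced_norm G \<beta> f =
     (SUP \<xi>\<in>{\<xi>. finite (gsupp G \<xi>) \<and> l2_norm G \<xi> \<le> 1}. l2_norm G (regular_rep G \<beta> f \<xi>))"

definition crossed_sum ::
    "('g, 'm) monoid_scheme \<Rightarrow> ('a::unital_cstar_algebra \<Rightarrow> 'b::unital_cstar_algebra) \<Rightarrow>
     ('g \<Rightarrow> 'b) \<Rightarrow> ('g \<Rightarrow> 'a) \<Rightarrow> 'b" where
  "crossed_sum G \<iota> u f = (\<Sum>g\<in>gsupp G f. \<iota> (f g) * u g)"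

text \<open>
  The reduced crossed product is the completion of the algebraic crossed product in the reduced
  norm. Since a type cannot depend on \<open>G\<close> and \<open>\<beta>\<close>, this is a property of a C*-algebra \<open>'b\<close> with a
  copy \<open>\<iota>\<close> of the coefficient algebra and unitaries \<open>u g\<close> (the \<open>\<lambda>\<^sub>g\<close>); it determines
  \<open>('b, \<iota>, u)\<close> up to a unique isomorphism.
\<close>

definition reduced_crossed_product ::
    "('g, 'm) monoid_scheme \<Rightarrow> ('g \<Rightarrow> 'a::unital_cstar_algebra \<Rightarrow> 'a) \<Rightarrow>
     ('a \<Rightarrow> 'b::unital_cstar_algebra) \<Rightarrow> ('g \<Rightarrow> 'b) \<Rightarrow> bool" where
  "reduced_crossed_product G \<beta> \<iota> u \<longleftrightarrow>
     star_hom \<iota> \<and>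
     (\<forall>g\<in>carrier G. unitary (u g)) \<and>
     (\<forall>g\<in>carrier G. \<forall>h\<in>carrier G. u (g \<otimes>\<^bsub>G\<^esub> h) = u g * u h) \<and>
     (\<forall>g\<in>carrier G. \<forall>a. u g * \<iota> a * star (u g) = \<iota> (\<beta> g a)) \<and>
     closure (crossed_sum G \<iota> u ` {f. finite (gsupp G f)}) = UNIV \<and>
     (\<forall>f. finite (gsupp G f) \<longrightarrow> norm (crossed_sum G \<iota> u f) = reduced_norm G \<beta> f)"

text \<open>
  The continuous linear extension of \<open>\<Sum>\<^sub>g f(g) \<lambda>\<^sub>g \<mapsto> f(e)\<close>. It exists because
  \<^term>\<open>norm (f \<one>\<^bsub>G\<^esub>) \<le> reduced_norm G \<beta> f\<close>, and density makes it unique.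
\<close>

definition canonical_expectation ::
    "('g, 'm) monoid_scheme \<Rightarrow> ('a::unital_cstar_algebra \<Rightarrow> 'b::unital_cstar_algebra) \<Rightarrow>
     ('g \<Rightarrow> 'b) \<Rightarrow> 'b \<Rightarrow> 'a" where
  "canonical_expectation G \<iota> u =
     (THE E. Vector_Spaces.linear scaleC scaleC E \<and> continuous_on UNIV E \<and>
             (\<forall>f. finite (gsupp G f) \<longrightarrow> E (crossed_sum G \<iota> u f) = f \<one>\<^bsub>G\<^esub>))"

definition crossed_filtration ::
    "('g, 'm) monoid_scheme \<Rightarrow> ('g \<Rightarrow> nat) \<Rightarrow> (nat \<Rightarrow> 'a set) \<Rightarrow>
     ('a::unital_cstar_algebra \<Rightarrow> 'b::unital_cstar_algebra) \<Rightarrow> ('g \<Rightarrow> 'b) \<Rightarrow> nat \<times> nat \<Rightarrow> 'b set" where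
  "crossed_filtration G l V \<iota> u = (\<lambda>(i, j). cspan {\<iota> a * u g |a g. a \<in> V i \<and> g \<in> carrier G \<and> l g = j})"

end

theory Submission
  imports Defs
begin

text \<open>
  Almost everything the theorem asserts is a computation with the monomials \<open>\<iota> a * u g\<close>. Since
  \<open>u\<^sub>g\<^sup>* \<iota>(a\<^sup>* b) u\<^sub>h = \<iota>(\<beta>\<^bsub>g\<^sup>-\<^sup>1\<^esub>(a\<^sup>* b)) u\<^bsub>g\<^sup>-\<^sup>1 h\<^esub>\<close>, the form \<open>\<tau> E(x\<^sup>* y)\<close> of two monomials vanishes unless
  \<open>g = h\<close>, where invariance turns it into \<open>\<tau>(a\<^sup>* b)\<close>; so different lengths are orthogonal because
  the group elements differ, and equal lengths with different indices are orthogonal because the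
  filtration of \<open>A\<close> is. Properness makes each piece finite-dimensional, and density follows from
  density in \<open>A\<close> because \<open>\<iota>\<close> is contractive.

  The substance is that the expectation \<open>E\<close> exists and that \<open>\<tau> \<circ> E\<close> is a faithful state. Both need
  order inequalities of the form \<open>\<parallel>p\<parallel> \<le> \<parallel>p + q\<parallel>\<close> for positive \<open>p, q\<close>. The faithful state gives them
  without spectral theory. Call a self-adjoint \<open>p\<close> positive if \<open>\<tau>(b\<^sup>* p b) \<ge> 0\<close> for all \<open>b\<close>; positive
  elements form a closed cone that contains all \<open>a\<^sup>* a\<close>. Square roots of \<open>1 - x\<close> with \<open>\<parallel>x\<parallel> \<le> 1\<close> come
  from a convergent iteration, hence so does \<open>\<bar>k\<bar>\<close> for self-adjoint \<open>k\<close>; if \<open>k\<close> is positive,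
  faithfulness kills the negative part \<open>(\<bar>k\<bar> - k) / 2\<close>, so positive elements are squares
  (\<open>positive_has_sqrt\<close>). Monotonicity of the norm (\<open>positive_norm_mono\<close>) then reduces to
  \<open>\<parallel>h\<^sup>2\<parallel> \<le> \<parallel>h\<^sup>2 + k\<^sup>2\<parallel>\<close> for commuting self-adjoint \<open>h, k\<close>, which is the C*-identity for \<open>h + \<i>k\<close>.

  With this the regular representation is bounded on finitely supported vectors, so the supremum
  that defines the reduced norm is genuine and dominates \<open>\<parallel>f(e)\<parallel>\<close>. Hence \<open>f \<mapsto> f(e)\<close> is a
  well-defined contraction on a dense subspace and extends to \<open>E\<close>.

  For faithfulness, identify a vector \<open>\<xi>\<close> with \<open>w\<^sub>\<xi> = \<Sum>\<^sub>g u\<^sub>g \<iota>(\<xi>(g))\<close>. Then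
  \<open>E(w\<^sub>\<xi>\<^sup>* w\<^sub>\<xi>) = \<langle>\<xi>, \<xi>\<rangle>\<close>, and the regular representation becomes left multiplication. Suppose
  \<open>\<tau> E(x\<^sup>* x) = 0\<close>. Then \<open>E(x\<^sup>* x) = 0\<close>; invariance of \<open>\<tau>\<close> gives \<open>E((x u\<^sub>g)\<^sup>* (x u\<^sub>g)) = 0\<close>, the module property
  of \<open>E\<close> gives the same for \<open>x u\<^sub>g \<iota>(a)\<close>, and the parallelogram law gives it for every \<open>x w\<^sub>\<xi>\<close>. So an
  algebraic element \<open>d\<close> acts on vectors as \<open>d - x\<close> does, and \<open>\<parallel>d\<parallel> \<le> 2 \<parallel>d - x\<parallel>\<close>. Letting \<open>d\<close> tend to
  \<open>x\<close> gives \<open>x = 0\<close>.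
\<close>

section \<open>Elementary facts about C*-algebras\<close>

lemma clinear_iff:
  "Vector_Spaces.linear scaleC scaleC f \<longleftrightarrow>
     (\<forall>x y. f (x + y) = f x + f y) \<and> (\<forall>c x. f (c *\<^sub>C x) = c *\<^sub>C f x)"
  for f :: "'a::unital_cstar_algebra \<Rightarrow> 'b::unital_cstar_algebra"
  by (simp add: Vector_Spaces.linear_iff cvec.vector_space_axioms)

lemma cfunctional_iff:
  "Vector_Spaces.linear scaleC (*) f \<longleftrightarrow>
     (\<forall>x y. f (x + y) = f x + f y) \<and> (\<forall>c x. f (c *\<^sub>C x) = c * f x)"
  for f :: "'a::unital_cstar_algebra \<Rightarrow> complex"
proof -
  have "vector_space ((*) :: complex \<Rightarrow> complex \<Rightarrow> complex)"
    by unfold_locales (simp_all add: algebra_simps)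
  then show ?thesis
    by (simp add: Vector_Spaces.linear_iff cvec.vector_space_axioms)
qed

lemma star_zero [simp]: "star (0::'a::unital_cstar_algebra) = 0"
  using star_add[of "0::'a" 0] by simp

lemma star_minus [simp]: "star (- x) = - star x" for x :: "'a::unital_cstar_algebra"
  using star_add[of x "- x"] by (simp add: add_eq_0_iff)

lemma star_diff: "star (x - y) = star x - star y" for x :: "'a::unital_cstar_algebra"
  using star_add[of x "- y"] by simp

lemma star_one [simp]: "star (1::'a::unital_cstar_algebra) = 1"
  using star_mult[of "star 1 :: 'a" 1] by (simp add: star_star)

lemma star_scaleR: "star (r *\<^sub>R x) = r *\<^sub>R star x" for x :: "'a::unital_cstar_algebra"
  by (simp add: star_scaleC flip: scaleC_of_real)

lemma star_sum: "star (sum f S) = (\<Sum>i\<in>S. star (f i :: 'a::unital_cstar_algebra))"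
  by (induction S rule: infinite_finite_induct) (simp_all add: star_add)

lemma norm_star [simp]: "norm (star x) = norm x" for x :: "'a::unital_cstar_algebra"
proof -
  have le: "norm y \<le> norm (star y)" for y :: 'a
  proof (cases "y = 0")
    case False
    have "norm y * norm y \<le> norm (star y) * norm y"
      using norm_mult_ineq[of "star y" y] by (simp add: cstar_identity power2_eq_square)
    with False show ?thesis by simp
  qed simp
  show ?thesis using le[of x] le[of "star x"] by (simp add: star_star)
qed

lemma tendsto_star [tendsto_intros]:
  fixes f :: "'i \<Rightarrow> 'a::unital_cstar_algebra"
  assumes "(f \<longlongrightarrow> x) F"
  shows "((\<lambda>i. star (f i)) \<longlongrightarrow> star x) F"
proof -
  have "bounded_linear (star :: 'a \<Rightarrow> 'a)"
    by (rule bounded_linear_intro[where K = 1]) (simp_all add: star_add star_scaleR)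
  then show ?thesis using assms by (rule bounded_linear.tendsto)
qed

lemma tendsto_scaleC [tendsto_intros]:
  fixes f :: "'i \<Rightarrow> 'a::unital_cstar_algebra"
  assumes "(f \<longlongrightarrow> x) F"
  shows "((\<lambda>i. c *\<^sub>C f i) \<longlongrightarrow> c *\<^sub>C x) F"
proof -
  have "bounded_linear (\<lambda>x::'a. c *\<^sub>C x)"
  proof (rule bounded_linear_intro[where K = "cmod c"])
    show "c *\<^sub>C r *\<^sub>R x = r *\<^sub>R c *\<^sub>C x" for r and x :: 'a
      by (simp add: scaleC_scaleC mult.commute flip: scaleC_of_real)
  qed (simp_all add: scaleC_add_right norm_scaleC)
  then show ?thesis using assms by (rule bounded_linear.tendsto)
qed

lemma norm_square_selfadjoint:
  "star x = x \<Longrightarrow> norm (x * x) = (norm x)\<^sup>2" for x :: "'a::unital_cstar_algebra"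
  using cstar_identity[of x] by simp

section \<open>Square roots of self-adjoint elements\<close>

text \<open>
  The fixed point of this iteration solves \<open>y = (x + y\<^sup>2) / 2\<close>, that is \<open>(1 - y)\<^sup>2 = 1 - x\<close>. The
  definition covers real scalars as well because the iteration for \<open>x = 1\<close> in the reals dominates
  every other one.
\<close>

primrec sqrt_iter :: "'a::real_normed_algebra_1 \<Rightarrow> nat \<Rightarrow> 'a" where
  "sqrt_iter x 0 = 0"
| "sqrt_iter x (Suc n) = (1 / 2) *\<^sub>R (x + sqrt_iter x n * sqrt_iter x n)"

lemma sqrt_iter_commute: "z * x = x * z \<Longrightarrow> z * sqrt_iter x n = sqrt_iter x n * z"
proof (induction n)
  case (Suc n)
  then have "z * (sqrt_iter x n * sqrt_iter x n) = sqrt_iter x n * sqrt_iter x n * z"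
    by (metis mult.assoc)
  with Suc.prems show ?case by (simp add: algebra_simps)
qed simp

lemma sqrt_iter_real: "0 \<le> sqrt_iter (1::real) n" "sqrt_iter (1::real) n \<le> 1"
  "sqrt_iter (1::real) n \<le> sqrt_iter 1 (Suc n)"
proof -
  show nn: "0 \<le> sqrt_iter (1::real) n" by (induction n) simp_all
  show le1: "sqrt_iter (1::real) n \<le> 1"
  proof (induction n)
    case (Suc n)
    have "0 \<le> sqrt_iter (1::real) n" by (induction n) simp_all
    with Suc have "sqrt_iter (1::real) n * sqrt_iter 1 n \<le> 1" by (simp add: mult_le_one)
    then show ?case by simp
  qed simp
  have "0 \<le> (1 - sqrt_iter (1::real) n)\<^sup>2" by simp
  then show "sqrt_iter (1::real) n \<le> sqrt_iter 1 (Suc n)"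
    by (simp add: power2_eq_square algebra_simps)
qed

text \<open>
  Consecutive iterates satisfy \<open>2 (s'' - s') = s'\<^sup>2 - s\<^sup>2 = (s' + s)(s' - s)\<close>, since they commute.
  The same identity for the real iteration carries the bound from one increment to the next.
\<close>

lemma sqrt_iter_dominated:
  assumes "norm x \<le> 1"
  shows "norm (sqrt_iter x n) \<le> sqrt_iter 1 n"
    and "norm (sqrt_iter x (Suc n) - sqrt_iter x n) \<le> sqrt_iter 1 (Suc n) - sqrt_iter 1 n"
proof -
  show bound: "norm (sqrt_iter x n) \<le> sqrt_iter 1 n" for n
  proof (induction n)
    case (Suc n)
    have "norm (sqrt_iter x n * sqrt_iter x n) \<le> sqrt_iter 1 n * sqrt_iter 1 n"
      by (rule order_trans[OF norm_mult_ineq]) (intro mult_mono Suc norm_ge_zero sqrt_iter_real)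
    with assms have "norm (x + sqrt_iter x n * sqrt_iter x n) \<le> 1 + sqrt_iter 1 n * sqrt_iter 1 n"
      by (intro order_trans[OF norm_triangle_ineq] add_mono)
    then show ?case by simp
  qed simp
  show "norm (sqrt_iter x (Suc n) - sqrt_iter x n) \<le> sqrt_iter 1 (Suc n) - sqrt_iter 1 n"
  proof (induction n)
    case 0
    from assms show ?case by simp
  next
    case (Suc n)
    let ?s = "sqrt_iter x" and ?t = "sqrt_iter (1::real)"
    have step: "sqrt_iter z (Suc (Suc n)) - sqrt_iter z (Suc n)
        = (1 / 2) *\<^sub>R ((sqrt_iter z (Suc n) + sqrt_iter z n) * (sqrt_iter z (Suc n) - sqrt_iter z n))"
      for z :: "'b::real_normed_algebra_1"
    proof -
      have c: "sqrt_iter z (Suc n) * sqrt_iter z n = sqrt_iter z n * sqrt_iter z (Suc n)"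
        by (intro sqrt_iter_commute sqrt_iter_commute[symmetric]) simp
      have "sqrt_iter z (Suc (Suc n)) - sqrt_iter z (Suc n)
          = (1 / 2) *\<^sub>R (z + sqrt_iter z (Suc n) * sqrt_iter z (Suc n))
            - (1 / 2) *\<^sub>R (z + sqrt_iter z n * sqrt_iter z n)"
        by (simp only: sqrt_iter.simps)
      also have "\<dots> = (1 / 2) *\<^sub>R (sqrt_iter z (Suc n) * sqrt_iter z (Suc n) - sqrt_iter z n * sqrt_iter z n)"
        by (simp only: scaleR_diff_right[symmetric]) simp
      also have "sqrt_iter z (Suc n) * sqrt_iter z (Suc n) - sqrt_iter z n * sqrt_iter z n
          = (sqrt_iter z (Suc n) + sqrt_iter z n) * (sqrt_iter z (Suc n) - sqrt_iter z n)"
        using c by (simp only: distrib_right right_diff_distrib) simp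
      finally show ?thesis .
    qed
    have "norm (?s (Suc n) + ?s n) \<le> ?t (Suc n) + ?t n"
      by (intro order_trans[OF norm_triangle_ineq] add_mono bound)
    then have "norm ((?s (Suc n) + ?s n) * (?s (Suc n) - ?s n))
        \<le> (?t (Suc n) + ?t n) * (?t (Suc n) - ?t n)"
      by (intro order_trans[OF norm_mult_ineq] mult_mono Suc norm_ge_zero add_nonneg_nonneg sqrt_iter_real)
    then show ?case
      unfolding step[of x] step[of "1::real"] norm_scaleR by simp
  qed
qed

text \<open>
  The real iteration increases and is bounded by \<open>1\<close>, so its increments are summable, and they
  majorise those of \<open>sqrt_iter x\<close>. This reaches the boundary case \<open>norm x = 1\<close>.
\<close>

lemma sqrt_iter_convergent:
  fixes x :: "'a::{real_normed_algebra_1, banach}"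
  assumes "norm x \<le> 1"
  shows "convergent (sqrt_iter x)"
proof -
  have "convergent (sqrt_iter (1::real))"
    by (intro Bseq_monoseq_convergent BseqI'[where K = 1] monoseq_Suc[THEN iffD2] disjI1 allI)
       (use sqrt_iter_real in auto)
  then have "summable (\<lambda>n. sqrt_iter (1::real) (Suc n) - sqrt_iter 1 n)"
    unfolding convergent_def using telescope_summable by blast
  then have "summable (\<lambda>n. sqrt_iter x (Suc n) - sqrt_iter x n)"
    by (rule summable_comparison_test'[where N = 0]) (rule sqrt_iter_dominated(2)[OF assms])
  then have "convergent (\<lambda>n. \<Sum>i<n. sqrt_iter x (Suc i) - sqrt_iter x i)"
    by (simp add: summable_iff_convergent)
  then show ?thesis by (simp only: sum_lessThan_telescope) simp
qed

text \<open>
  The root is \<open>1 - y\<close>. That \<open>y\<close> again has norm at most \<open>1\<close> allows a root of the root to be taken;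
  that it commutes with everything commuting with \<open>x\<close> replaces the functional calculus.
\<close>

lemma one_minus_has_sqrt:
  fixes x :: "'a::unital_cstar_algebra"
  assumes "star x = x" and "norm x \<le> 1"
  obtains y where "star y = y" "norm y \<le> 1" "(1 - y) * (1 - y) = 1 - x"
    and "\<And>z. z * x = x * z \<Longrightarrow> z * y = y * z"
proof -
  obtain y where y: "sqrt_iter x \<longlonglongrightarrow> y"
    using sqrt_iter_convergent[OF assms(2)] by (auto simp: convergent_def)
  have "star (sqrt_iter x n) = sqrt_iter x n" for n
    by (induction n) (simp_all add: star_scaleR star_add star_mult assms)
  with tendsto_star[OF y] y have star: "star y = y"
    by (auto intro: LIMSEQ_unique)
  have "norm (sqrt_iter x n) \<le> 1" for n
    using sqrt_iter_dominated(1)[OF assms(2)] sqrt_iter_real(2) order_trans by blast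
  with y have norm: "norm y \<le> 1"
    by (intro Lim_norm_ubound[of sequentially]) auto
  have "(\<lambda>n. (1 / 2) *\<^sub>R (x + sqrt_iter x n * sqrt_iter x n)) \<longlonglongrightarrow> (1 / 2) *\<^sub>R (x + y * y)"
    by (intro tendsto_intros y)
  then have "sqrt_iter x \<longlonglongrightarrow> (1 / 2) *\<^sub>R (x + y * y)"
    by (subst filterlim_sequentially_Suc[symmetric]) simp
  with y have fixpoint: "y = (1 / 2) *\<^sub>R (x + y * y)"
    by (rule LIMSEQ_unique)
  have "y + y = x + y * y"
    by (subst (1 2) fixpoint) (simp flip: scaleR_add_left)
  then have sq: "(1 - y) * (1 - y) = 1 - x"
    by (simp add: algebra_simps)
  have comm: "z * y = y * z" if "z * x = x * z" for z
  proof (rule LIMSEQ_unique)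
    show "(\<lambda>n. z * sqrt_iter x n) \<longlonglongrightarrow> z * y" by (intro tendsto_intros y)
    show "(\<lambda>n. z * sqrt_iter x n) \<longlonglongrightarrow> y * z"
      unfolding sqrt_iter_commute[OF that] by (intro tendsto_intros y)
  qed
  from that[OF star norm sq comm] show thesis .
qed

lemma scalar_minus_has_sqrt:
  fixes x :: "'a::unital_cstar_algebra"
  assumes "star x = x" and "norm x \<le> r"
  obtains b where "star b = b" "b * b = r *\<^sub>R 1 - x"
proof (cases "r = 0")
  case True
  with assms that[of 0] show thesis by simp
next
  case False
  with assms have r: "r > 0" using norm_ge_zero[of x] by linarith
  have "star ((1 / r) *\<^sub>R x) = (1 / r) *\<^sub>R x" "norm ((1 / r) *\<^sub>R x) \<le> 1"
    using assms r by (simp_all add: star_scaleR)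
  then obtain y where y: "star y = y" "(1 - y) * (1 - y) = 1 - (1 / r) *\<^sub>R x"
    by (rule one_minus_has_sqrt)
  show thesis
  proof (rule that)
    show "star (sqrt r *\<^sub>R (1 - y)) = sqrt r *\<^sub>R (1 - y)"
      by (simp add: star_scaleR star_diff y)
    show "sqrt r *\<^sub>R (1 - y) * sqrt r *\<^sub>R (1 - y) = r *\<^sub>R 1 - x"
      using r by (simp only: mult_scaleR_left mult_scaleR_right y(2)) (simp add: scaleR_diff_right)
  qed
qed

text \<open>
  The element \<open>v = h + \<i>k\<close> is normal with \<open>v\<^sup>* v = h\<^sup>2 + k\<^sup>2\<close>, and \<open>h\<close> is its real part, so
  \<open>norm h \<le> norm v\<close>.
\<close>

lemma norm_le_commuting_squares:
  fixes h k :: "'a::unital_cstar_algebra"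
  assumes "star h = h" "star k = k" "h * k = k * h"
  shows "(norm h)\<^sup>2 \<le> norm (h * h + k * k)"
proof -
  define v where "v = h + \<i> *\<^sub>C k"
  have star_v: "star v = h + (- \<i>) *\<^sub>C k"
    by (simp add: v_def star_add star_scaleC assms)
  have "star v * v = h * h + k * k"
    unfolding star_v unfolding v_def
    by (simp add: algebra_simps mult_scaleC_left mult_scaleC_right scaleC_scaleC assms(3)
        flip: scaleC_add_left)
  then have norm_v: "(norm v)\<^sup>2 = norm (h * h + k * k)"
    by (simp flip: cstar_identity)
  have "v + star v = h + h"
    unfolding star_v unfolding v_def by (simp add: algebra_simps flip: scaleC_add_left)
  then have "2 * norm h \<le> norm v + norm (star v)"
    by (metis norm_triangle_ineq norm_scaleR scaleR_2 abs_numeral)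
  then have "norm h \<le> norm v" by simp
  then show ?thesis unfolding norm_v[symmetric] by (rule power_mono) simp
qed

section \<open>Positivity with respect to a faithful state\<close>

locale cstar_faithful_state =
  fixes \<tau> :: "'a::unital_cstar_algebra \<Rightarrow> complex"
  assumes state: "faithful_state \<tau>"
begin

lemma state_add: "\<tau> (x + y) = \<tau> x + \<tau> y"
  and state_scaleC: "\<tau> (c *\<^sub>C x) = c * \<tau> x"
  and state_one: "\<tau> 1 = 1"
  and state_square: "\<tau> (star a * a) \<in> \<real>\<^sub>\<ge>\<^sub>0"
  and state_faithful: "\<tau> (star a * a) = 0 \<Longrightarrow> a = 0"
  using state by (auto simp: faithful_state_def cfunctional_iff)

lemma state_scaleR: "\<tau> (r *\<^sub>R x) = of_real r * \<tau> x"
  by (simp add: state_scaleC flip: scaleC_of_real)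

lemma state_minus: "\<tau> (- x) = - \<tau> x"
  using state_scaleR[of "- 1" x] by simp

lemma state_diff: "\<tau> (x - y) = \<tau> x - \<tau> y"
  using state_add[of x "- y"] by (simp add: state_minus)

text \<open>
  This is positivity of the operator of left multiplication by \<open>p\<close> in the GNS representation of
  \<open>\<tau>\<close>. It is visibly closed under sums and limits, properties that are hard to obtain directly
  for elements of the form \<open>star a * a\<close>.
\<close>

definition positive :: "'a \<Rightarrow> bool" where
  "positive p \<longleftrightarrow> star p = p \<and> (\<forall>b. \<tau> (star b * p * b) \<in> \<real>\<^sub>\<ge>\<^sub>0)"

lemma positive_star_mult: "positive (star a * a)"
proof -
  have "\<tau> (star b * (star a * a) * b) \<in> \<real>\<^sub>\<ge>\<^sub>0" for b
    using state_square[of "a * b"] by (simp add: star_mult mult.assoc)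
  then show ?thesis by (simp add: positive_def star_mult star_star)
qed

lemma positive_add: "positive p \<Longrightarrow> positive q \<Longrightarrow> positive (p + q)"
  by (simp add: positive_def star_add distrib_left distrib_right state_add)

lemma positive_zero: "positive 0"
  using positive_star_mult[of 0] by simp

lemma positive_sum: "(\<And>i. i \<in> S \<Longrightarrow> positive (f i)) \<Longrightarrow> positive (sum f S)"
  by (induction S rule: infinite_finite_induct) (auto intro: positive_zero positive_add)

lemma positive_scaleR: "positive p \<Longrightarrow> 0 \<le> r \<Longrightarrow> positive (r *\<^sub>R p)"
  by (simp add: positive_def star_scaleR state_scaleR)

lemma state_positive: "positive p \<Longrightarrow> \<tau> p \<in> \<real>\<^sub>\<ge>\<^sub>0"
  unfolding positive_def by (metis mult_1_left mult_1_right star_one)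

text \<open>
  Let \<open>a = \<bar>k\<bar>\<close>, the square root of \<open>k\<^sup>2\<close>, and let \<open>q\<close> be the square root of \<open>a\<close>. For \<open>p = a - k\<close>,
  twice the negative part of \<open>k\<close>, the relation \<open>k p = - a p\<close> gives \<open>p k p = - (q p)\<^sup>* (q p)\<close>. Positivity
  of \<open>k\<close> and faithfulness force \<open>q p = 0\<close>, from which \<open>p = 0\<close> and \<open>k = a = q\<^sup>2\<close>.
\<close>

lemma positive_contraction_has_sqrt:
  assumes pos: "positive k" and norm_k: "norm k \<le> 1"
  obtains q where "star q = q" "q * q = k" and "\<And>z. z * k = k * z \<Longrightarrow> z * q = q * z"
proof -
  have star_k: "star k = k" using pos by (simp add: positive_def)
  have star_kk: "star (k * k) = k * k" by (simp add: star_mult star_k)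
  have "norm (k * k) \<le> 1"
    by (simp add: norm_square_selfadjoint star_k power_le_one norm_k)
  from one_minus_has_sqrt[OF star_kk this]
  obtain y where y: "star y = y" "(1 - y) * (1 - y) = 1 - k * k"
    "\<And>z. z * (k * k) = k * k * z \<Longrightarrow> z * y = y * z"
    by metis
  \<comment> \<open>As \<open>(1 - y)\<^sup>2 + k\<^sup>2 = 1\<close>, this shows \<open>norm (1 - k\<^sup>2) \<le> 1\<close>, so \<open>k\<^sup>2 = 1 - (1 - k\<^sup>2)\<close> has a root.\<close>
  have "(norm (1 - y))\<^sup>2 \<le> norm ((1 - y) * (1 - y) + k * k)"
    using y(3)[of k]
    by (intro norm_le_commuting_squares) (simp_all add: star_diff y(1) star_k algebra_simps)
  then have "(norm (1 - y))\<^sup>2 \<le> 1" by (simp add: y(2))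
  then have "norm (1 - k * k) \<le> 1"
    by (simp add: norm_square_selfadjoint star_diff y(1) flip: y(2))
  moreover have "star (1 - k * k) = 1 - k * k" by (simp add: star_diff star_kk)
  ultimately obtain y1 where y1: "star y1 = y1" "norm y1 \<le> 1" "(1 - y1) * (1 - y1) = 1 - (1 - k * k)"
    "\<And>z. z * (1 - k * k) = (1 - k * k) * z \<Longrightarrow> z * y1 = y1 * z"
    by (metis one_minus_has_sqrt)
  from one_minus_has_sqrt[OF y1(1,2)]
  obtain y2 where y2: "star y2 = y2" "(1 - y2) * (1 - y2) = 1 - y1"
    "\<And>z. z * y1 = y1 * z \<Longrightarrow> z * y2 = y2 * z"
    by metis
  define a where "a = 1 - y1"
  define q where "q = 1 - y2"
  define p where "p = a - k"
  have q: "star q = q" "q * q = a" by (simp_all add: q_def a_def y2 star_diff)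
  have a: "star a = a" "a * a = k * k" by (simp_all add: a_def y1 star_diff)
  have comm_y1: "z * y1 = y1 * z" if "z * k = k * z" for z
  proof (rule y1(4))
    have "z * (k * k) = k * k * z" by (metis that mult.assoc)
    then show "z * (1 - k * k) = (1 - k * k) * z" by (simp add: algebra_simps)
  qed
  have ka: "k * a = a * k" using comm_y1[of k] by (simp add: a_def algebra_simps)
  have star_p: "star p = p" by (simp add: p_def star_diff a(1) star_k)
  have kp: "k * p = - (a * p)" by (simp add: p_def algebra_simps ka a(2))
  have square: "star (q * p) * (q * p) = p * a * p"
    by (simp add: star_mult star_p q(1) mult.assoc flip: q(2))
  have "\<tau> (star p * k * p) \<in> \<real>\<^sub>\<ge>\<^sub>0" using pos by (simp add: positive_def)
  also have "star p * k * p = - (p * a * p)" by (simp add: star_p mult.assoc kp)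
  finally have "\<tau> (star (q * p) * (q * p)) = 0"
    using state_square[of "q * p"] by (simp add: square state_minus complex_nonneg_Reals_iff complex_eq_iff)
  then have "q * p = 0" by (rule state_faithful)
  then have ap: "a * p = 0" by (simp add: mult.assoc flip: q(2))
  with kp have "k * p = 0" by simp
  with ap have "p * p = 0" by (simp add: p_def left_diff_distrib)
  then have "p = 0" using norm_square_selfadjoint[OF star_p] by simp
  then have "a = k" by (simp add: p_def)
  show thesis
  proof (rule that)
    show "star q = q" "q * q = k" by (simp_all add: q \<open>a = k\<close>)
    show "z * q = q * z" if "z * k = k * z" for z
      using y2(3)[OF comm_y1[OF that]] by (simp add: q_def algebra_simps)
  qed
qed

lemma positive_has_sqrt:
  assumes pos: "positive k"
  obtains q where "star q = q" "q * q = k" and "\<And>z. z * k = k * z \<Longrightarrow> z * q = q * z"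
proof -
  define r where "r = norm k + 1"
  have r: "r > 0" by (simp add: r_def add_nonneg_pos)
  have "norm ((1 / r) *\<^sub>R k) \<le> 1" using r by (simp add: r_def)
  moreover have "positive ((1 / r) *\<^sub>R k)" using pos r by (intro positive_scaleR) auto
  ultimately obtain q where q: "star q = q" "q * q = (1 / r) *\<^sub>R k"
    "\<And>z. z * ((1 / r) *\<^sub>R k) = (1 / r) *\<^sub>R k * z \<Longrightarrow> z * q = q * z"
    by (metis positive_contraction_has_sqrt)
  show thesis
  proof (rule that)
    show "star (sqrt r *\<^sub>R q) = sqrt r *\<^sub>R q" by (simp add: star_scaleR q)
    show "sqrt r *\<^sub>R q * sqrt r *\<^sub>R q = k" using r by (simp add: q(2))
    show "z * sqrt r *\<^sub>R q = sqrt r *\<^sub>R q * z" if "z * k = k * z" for z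
      using q(3)[of z] that by simp
  qed
qed

text \<open>
  With \<open>r = norm (p + q)\<close>, both \<open>p\<close> and \<open>r - p\<close> are positive, hence squares \<open>y\<^sup>2\<close> and \<open>z\<^sup>2\<close> of
  commuting self-adjoint elements, and \<open>y\<^sup>2 + z\<^sup>2 = r\<close>.
\<close>

lemma positive_norm_mono:
  assumes "positive p" "positive q"
  shows "norm p \<le> norm (p + q)"
proof -
  let ?r = "norm (p + q)"
  have "star (p + q) = p + q" using positive_add[OF assms] by (simp add: positive_def)
  then obtain c where c: "star c = c" "c * c = ?r *\<^sub>R 1 - (p + q)"
    using scalar_minus_has_sqrt[OF _ order_refl] by metis
  have "positive (star c * c + q)" using positive_star_mult assms(2) by (rule positive_add)
  moreover have "star c * c + q = ?r *\<^sub>R 1 - p" by (simp add: c)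
  ultimately have "positive (?r *\<^sub>R 1 - p)" by simp
  from positive_has_sqrt[OF this]
  obtain z where z: "star z = z" "z * z = ?r *\<^sub>R 1 - p"
    "\<And>w. w * (?r *\<^sub>R 1 - p) = (?r *\<^sub>R 1 - p) * w \<Longrightarrow> w * z = z * w"
    by metis
  obtain y where y: "star y = y" "y * y = p"
    using positive_has_sqrt[OF assms(1)] by metis
  have "y * p = p * y" by (simp add: mult.assoc flip: y(2))
  then have "y * z = z * y" by (intro z(3)) (simp add: algebra_simps)
  then have "(norm y)\<^sup>2 \<le> norm (y * y + z * z)"
    using y z by (intro norm_le_commuting_squares)
  then show ?thesis by (simp add: y(2) z(2) flip: norm_square_selfadjoint[OF y(1)])
qed

lemma positive_state_zero:
  assumes "positive p" "\<tau> p = 0"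
  shows "p = 0"
proof -
  obtain q where "star q = q" "q * q = p" using positive_has_sqrt[OF assms(1)] by metis
  with assms(2) state_faithful[of q] show ?thesis by auto
qed

text \<open>
  Both \<open>norm a - a\<close> and \<open>norm a + a\<close> are squares, so \<open>\<tau>\<close> is nonnegative on them.
\<close>

lemma state_selfadjoint_bound:
  assumes "star a = a"
  shows "cmod (\<tau> a) \<le> norm a"
proof -
  have le: "of_real (norm b) - \<tau> b \<in> \<real>\<^sub>\<ge>\<^sub>0" if b: "star b = b" for b
  proof -
    obtain c where "star c = c" "c * c = norm b *\<^sub>R 1 - b"
      using scalar_minus_has_sqrt[OF b order_refl] by metis
    with state_square[of c] show ?thesis by (simp add: state_diff state_scaleR state_one)
  qed
  from le[of a] le[of "- a"] assms have "Im (\<tau> a) = 0" "\<bar>Re (\<tau> a)\<bar> \<le> norm a"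
    by (auto simp: state_minus complex_nonneg_Reals_iff)
  then show ?thesis by (simp add: cmod_def)
qed

lemma state_bound: "cmod (\<tau> a) \<le> 2 * norm a"
proof -
  define h where "h = (1 / 2) *\<^sub>R (a + star a)"
  define k where "k = (\<i> / 2) *\<^sub>C (star a - a)"
  have a: "a = h + \<i> *\<^sub>C k"
  proof -
    have "\<i> *\<^sub>C k = (1 / 2) *\<^sub>R (a - star a)"
      using scaleC_of_real[of "- 1 / 2" "star a - a"]
      by (simp add: k_def scaleC_scaleC scaleR_diff_right)
    then have "h + \<i> *\<^sub>C k = (1 / 2) *\<^sub>R (a + a)"
      by (simp add: h_def scaleR_add_right scaleR_diff_right)
    then show ?thesis by (simp flip: scaleR_2)
  qed
  have h: "star h = h" "norm h \<le> norm a"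
    using norm_triangle_ineq[of a "star a"]
    by (simp_all add: h_def star_scaleR star_add star_star add.commute)
  have k: "star k = k"
  proof -
    have "star k = (- (\<i> / 2)) *\<^sub>C (- (star a - a))"
      by (simp add: k_def star_scaleC star_diff star_star)
    also have "\<dots> = k"
      by (simp only: k_def cvec.scale_minus_left cvec.scale_minus_right minus_minus)
    finally show ?thesis .
  qed
  have "norm k \<le> norm a"
    using norm_triangle_ineq4[of "star a" a] by (simp add: k_def norm_scaleC norm_divide)
  moreover have "cmod (\<tau> a) \<le> cmod (\<tau> h) + cmod (\<tau> k)"
    unfolding a state_add state_scaleC
    by (rule order_trans[OF norm_triangle_ineq]) (simp add: norm_mult)
  ultimately show ?thesis
    using state_selfadjoint_bound[OF h(1)] state_selfadjoint_bound[OF k] h(2) by linarith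
qed

lemma tendsto_state [tendsto_intros]:
  assumes "(f \<longlongrightarrow> x) F"
  shows "((\<lambda>i. \<tau> (f i)) \<longlongrightarrow> \<tau> x) F"
proof -
  have "bounded_linear \<tau>"
  proof (rule bounded_linear_intro[where K = 2])
    show "\<tau> (r *\<^sub>R x) = r *\<^sub>R \<tau> x" for r x
      by (simp only: state_scaleR scaleR_conv_of_real[where 'a = complex])
  qed (use state_bound in \<open>simp_all add: state_add mult.commute\<close>)
  then show ?thesis using assms by (rule bounded_linear.tendsto)
qed

lemma positive_limit:
  assumes "f \<longlonglongrightarrow> p" "\<And>n. positive (f n)"
  shows "positive p"
proof -
  have "star p = p"
    using tendsto_star[OF assms(1)] assms by (auto simp: positive_def intro: LIMSEQ_unique)
  moreover have "\<tau> (star b * p * b) \<in> \<real>\<^sub>\<ge>\<^sub>0" for b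
  proof (rule closed_sequentially[OF closed_nonneg_Reals_complex])
    show "(\<lambda>n. \<tau> (star b * f n * b)) \<longlonglongrightarrow> \<tau> (star b * p * b)"
      by (intro tendsto_intros assms(1))
  qed (use assms(2) in \<open>simp add: positive_def\<close>)
  ultimately show ?thesis by (simp add: positive_def)
qed

end

section \<open>The regular representation\<close>

locale cstar_dynamical_system = cstar_faithful_state \<tau> + group G
  for \<tau> :: "'a::unital_cstar_algebra \<Rightarrow> complex" and G :: "('g, 'm) monoid_scheme" (structure) +
  fixes \<beta> :: "'g \<Rightarrow> 'a \<Rightarrow> 'a"
  assumes action: "cstar_action G \<beta>"
begin

abbreviation finsupp :: "('g \<Rightarrow> 'x::zero) \<Rightarrow> bool" where
  "finsupp \<xi> \<equiv> finite (gsupp G \<xi>)"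

definition single :: "'g \<Rightarrow> 'a \<Rightarrow> 'g \<Rightarrow> 'a" where
  "single g a h = (if h = g then a else 0)"

definition vector_square :: "('g \<Rightarrow> 'a) \<Rightarrow> 'a" where
  "vector_square \<xi> = (\<Sum>g\<in>gsupp G \<xi>. star (\<xi> g) * \<xi> g)"

text \<open>
  The operator \<open>\<pi>(a) \<lambda>\<^sub>h\<close>; every operator of the regular representation is a finite sum of these.
\<close>

definition shift_mult :: "'a \<Rightarrow> 'g \<Rightarrow> ('g \<Rightarrow> 'a) \<Rightarrow> 'g \<Rightarrow> 'a" where
  "shift_mult a h \<xi> g = \<beta> (inv g) a * \<xi> (inv h \<otimes> g)"

lemma action_hom:
  assumes "g \<in> carrier G"
  shows action_add: "\<beta> g (a + b) = \<beta> g a + \<beta> g b"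
    and action_scaleC: "\<beta> g (c *\<^sub>C a) = c *\<^sub>C \<beta> g a"
    and action_mult: "\<beta> g (a * b) = \<beta> g a * \<beta> g b"
    and action_star: "\<beta> g (star a) = star (\<beta> g a)"
    and action_unit: "\<beta> g 1 = 1"
  using action assms unfolding cstar_action_def star_hom_def clinear_iff by simp_all

lemma action_zero: "g \<in> carrier G \<Longrightarrow> \<beta> g 0 = 0"
  using action_add[of g 0 0] by simp

lemma action_scaleR: "g \<in> carrier G \<Longrightarrow> \<beta> g (r *\<^sub>R a) = r *\<^sub>R \<beta> g a"
  by (simp add: action_scaleC flip: scaleC_of_real)

lemma action_comp: "g \<in> carrier G \<Longrightarrow> h \<in> carrier G \<Longrightarrow> \<beta> g (\<beta> h a) = \<beta> (g \<otimes> h) a"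
  using action unfolding cstar_action_def by simp

lemma action_one: "\<beta> \<one> a = a"
proof -
  have "inj (\<beta> \<one>)" using action unfolding cstar_action_def by (auto simp: bij_is_inj)
  moreover have "\<beta> \<one> (\<beta> \<one> a) = \<beta> \<one> a" by (simp add: action_comp)
  ultimately show ?thesis by (simp add: inj_eq)
qed

lemma action_inv: "g \<in> carrier G \<Longrightarrow> \<beta> (inv g) (\<beta> g a) = a" "g \<in> carrier G \<Longrightarrow> \<beta> g (\<beta> (inv g) a) = a"
  by (simp_all add: action_comp action_one)

lemma gsupp_subset: "gsupp G \<xi> \<subseteq> carrier G"
  by (auto simp: gsupp_def)

lemma sum_gsupp:
  assumes "finite F" "gsupp G \<xi> \<subseteq> F" "F \<subseteq> carrier G" "\<And>g. g \<in> F \<Longrightarrow> \<xi> g = 0 \<Longrightarrow> w g = 0"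
  shows "sum w (gsupp G \<xi>) = sum w F"
  by (rule sum.mono_neutral_left) (use assms in \<open>auto simp: gsupp_def\<close>)

lemma vector_square_superset:
  "finite F \<Longrightarrow> gsupp G \<xi> \<subseteq> F \<Longrightarrow> F \<subseteq> carrier G \<Longrightarrow>
     vector_square \<xi> = (\<Sum>g\<in>F. star (\<xi> g) * \<xi> g)"
  unfolding vector_square_def by (rule sum_gsupp) simp_all

lemma positive_vector_square: "positive (vector_square \<xi>)"
  unfolding vector_square_def by (intro positive_sum positive_star_mult)

lemma l2_norm_eq: "l2_norm G \<xi> = sqrt (norm (vector_square \<xi>))"
  by (simp add: l2_norm_def vector_square_def)

lemma regular_rep_superset:
  assumes "finite F" "gsupp G f \<subseteq> F" "F \<subseteq> carrier G" "g \<in> carrier G"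
  shows "regular_rep G \<beta> f \<xi> g = (\<Sum>h\<in>F. shift_mult (f h) h \<xi> g)"
  unfolding regular_rep_def shift_mult_def
  by (rule sum_gsupp[OF assms(1-3)]) (use assms in \<open>simp add: action_zero\<close>)

lemma regular_rep_eq: "regular_rep G \<beta> f \<xi> = (\<lambda>g. \<Sum>h\<in>gsupp G f. shift_mult (f h) h \<xi> g)"
  by (simp add: regular_rep_def shift_mult_def fun_eq_iff)

lemma vector_square_cong: "(\<And>g. g \<in> carrier G \<Longrightarrow> \<xi> g = \<eta> g) \<Longrightarrow> vector_square \<xi> = vector_square \<eta>"
  unfolding vector_square_def by (rule sum.cong) (auto simp: gsupp_def)

lemma finsupp_single: "finsupp (single g a)"
  by (rule finite_subset[of _ "{g}"]) (auto simp: gsupp_def single_def)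

text \<open>
  The parallelogram law together with monotonicity of the norm. The factor \<open>2\<close> is the price for
  avoiding the Cauchy--Schwarz inequality of Hilbert modules; it is harmless because only
  boundedness and vanishing matter below.
\<close>

lemma vector_square_add_le:
  assumes "finsupp \<xi>" "finsupp \<eta>"
  shows "finsupp (\<lambda>g. \<xi> g + \<eta> g)"
    and "norm (vector_square (\<lambda>g. \<xi> g + \<eta> g)) \<le> 2 * norm (vector_square \<xi>) + 2 * norm (vector_square \<eta>)"
proof -
  let ?F = "gsupp G \<xi> \<union> gsupp G \<eta>"
  have F: "finite ?F" "?F \<subseteq> carrier G" using assms by (auto simp: gsupp_def)
  have sub: "gsupp G (\<lambda>g. \<xi> g + \<eta> g) \<subseteq> ?F" "gsupp G (\<lambda>g. \<xi> g - \<eta> g) \<subseteq> ?F"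
    by (auto simp: gsupp_def)
  show "finsupp (\<lambda>g. \<xi> g + \<eta> g)" using F(1) sub(1) finite_subset by blast
  have "vector_square (\<lambda>g. \<xi> g + \<eta> g) + vector_square (\<lambda>g. \<xi> g - \<eta> g)
      = 2 *\<^sub>R vector_square \<xi> + 2 *\<^sub>R vector_square \<eta>"
    unfolding vector_square_superset[OF F(1) sub(1) F(2)] vector_square_superset[OF F(1) sub(2) F(2)]
      vector_square_superset[OF F(1) Un_upper1 F(2)] vector_square_superset[OF F(1) Un_upper2 F(2)]
      scaleR_sum_right sum.distrib[symmetric]
    by (rule sum.cong) (simp_all add: star_add star_diff algebra_simps scaleR_2)
  then have "norm (vector_square (\<lambda>g. \<xi> g + \<eta> g)) \<le> norm (2 *\<^sub>R vector_square \<xi> + 2 *\<^sub>R vector_square \<eta>)"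
    using positive_norm_mono[OF positive_vector_square positive_vector_square] by metis
  also have "\<dots> \<le> 2 * norm (vector_square \<xi>) + 2 * norm (vector_square \<eta>)"
    by (rule order_trans[OF norm_triangle_ineq]) simp
  finally show "norm (vector_square (\<lambda>g. \<xi> g + \<eta> g)) \<le> 2 * norm (vector_square \<xi>) + 2 * norm (vector_square \<eta>)" .
qed

lemma inv_mult_eq_one:
  assumes "g \<in> carrier G" "h \<in> carrier G"
  shows "inv g \<otimes> h = \<one> \<longleftrightarrow> g = h"
proof
  assume "inv g \<otimes> h = \<one>"
  then have "g \<otimes> (inv g \<otimes> h) = g" using assms by simp
  then show "g = h" using assms by (simp flip: m_assoc)
qed (simp add: assms)

lemma inj_on_translate: "h \<in> carrier G \<Longrightarrow> inj_on (\<lambda>k. h \<otimes> k) (gsupp G \<xi>)"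
  by (rule inj_onI) (auto simp: gsupp_def)

lemma gsupp_shift_mult:
  assumes "h \<in> carrier G"
  shows "gsupp G (shift_mult a h \<xi>) \<subseteq> (\<lambda>k. h \<otimes> k) ` gsupp G \<xi>"
proof
  fix g assume "g \<in> gsupp G (shift_mult a h \<xi>)"
  then have g: "g \<in> carrier G" "\<xi> (inv h \<otimes> g) \<noteq> 0" by (auto simp: gsupp_def shift_mult_def)
  then have "inv h \<otimes> g \<in> gsupp G \<xi>" "g = h \<otimes> (inv h \<otimes> g)"
    using assms by (auto simp: gsupp_def simp flip: m_assoc)
  then show "g \<in> (\<lambda>k. h \<otimes> k) ` gsupp G \<xi>" by blast
qed

text \<open>
  Translation by \<open>h\<close> only reindexes the inner product. For the coefficient write
  \<open>star a * a + b * b = (norm a)\<^sup>2\<close>; the vectors obtained from \<open>a\<close> and \<open>b\<close> then have inner squares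
  adding up to \<open>(norm a)\<^sup>2\<close> times that of \<open>\<xi>\<close>, and monotonicity of the norm drops the second one.
\<close>

lemma shift_mult_bound:
  assumes h: "h \<in> carrier G" and \<xi>: "finsupp \<xi>"
  shows "finsupp (shift_mult a h \<xi>)"
    and "norm (vector_square (shift_mult a h \<xi>)) \<le> (norm a)\<^sup>2 * norm (vector_square \<xi>)"
proof -
  let ?F = "(\<lambda>k. h \<otimes> k) ` gsupp G \<xi>"
  have F: "finite ?F" "?F \<subseteq> carrier G" using \<xi> h by (auto simp: gsupp_def)
  show "finsupp (shift_mult a h \<xi>)"
    using gsupp_shift_mult[OF h] F(1) finite_subset by blast
  have "star (star a * a) = star a * a" "norm (star a * a) \<le> (norm a)\<^sup>2"
    by (simp_all add: star_mult star_star cstar_identity)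
  then obtain b where b: "star b = b" "b * b = (norm a)\<^sup>2 *\<^sub>R 1 - star a * a"
    by (rule scalar_minus_has_sqrt)
  have inj: "inj_on (\<lambda>k. h \<otimes> k) (gsupp G \<xi>)"
    by (rule inj_on_translate[OF h])
  have "vector_square \<xi> = (\<Sum>g\<in>?F. star (\<xi> (inv h \<otimes> g)) * \<xi> (inv h \<otimes> g))"
    unfolding vector_square_def sum.reindex[OF inj]
    by (rule sum.cong) (use h in \<open>auto simp: gsupp_def simp flip: m_assoc\<close>)
  moreover have "(norm a)\<^sup>2 *\<^sub>R (star (\<xi> (inv h \<otimes> g)) * \<xi> (inv h \<otimes> g))
      = star (shift_mult a h \<xi> g) * shift_mult a h \<xi> g + star (shift_mult b h \<xi> g) * shift_mult b h \<xi> g"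
    if "g \<in> ?F" for g
  proof -
    have g: "inv g \<in> carrier G" using that F(2) by auto
    have "star (\<beta> (inv g) a) * \<beta> (inv g) a + star (\<beta> (inv g) b) * \<beta> (inv g) b
        = \<beta> (inv g) (star a * a + b * b)"
      by (simp add: action_hom[OF g] b(1) flip: action_star[OF g])
    also have "\<dots> = (norm a)\<^sup>2 *\<^sub>R 1"
      by (simp add: b(2) action_scaleR action_unit g)
    finally have sum: "star (\<beta> (inv g) a) * \<beta> (inv g) a + star (\<beta> (inv g) b) * \<beta> (inv g) b
        = (norm a)\<^sup>2 *\<^sub>R 1" .
    have "star (shift_mult a h \<xi> g) * shift_mult a h \<xi> g + star (shift_mult b h \<xi> g) * shift_mult b h \<xi> g
       = star (\<xi> (inv h \<otimes> g))
          * (star (\<beta> (inv g) a) * \<beta> (inv g) a + star (\<beta> (inv g) b) * \<beta> (inv g) b) * \<xi> (inv h \<otimes> g)"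
      by (simp add: shift_mult_def star_mult distrib_left distrib_right mult.assoc)
    then show ?thesis by (simp add: sum)
  qed
  ultimately have "(norm a)\<^sup>2 *\<^sub>R vector_square \<xi>
      = vector_square (shift_mult a h \<xi>) + vector_square (shift_mult b h \<xi>)"
    by (simp add: vector_square_superset[OF F(1) gsupp_shift_mult[OF h] F(2)] scaleR_sum_right sum.distrib)
  then have "norm (vector_square (shift_mult a h \<xi>)) \<le> norm ((norm a)\<^sup>2 *\<^sub>R vector_square \<xi>)"
    using positive_norm_mono[OF positive_vector_square positive_vector_square] by metis
  then show "norm (vector_square (shift_mult a h \<xi>)) \<le> (norm a)\<^sup>2 * norm (vector_square \<xi>)"
    by simp
qed

lemma regular_rep_bounded:
  assumes "finsupp f"
  obtains C where "\<And>\<xi>. finsupp \<xi> \<Longrightarrow> finsupp (regular_rep G \<beta> f \<xi>)"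
    and "\<And>\<xi>. finsupp \<xi> \<Longrightarrow> norm (vector_square (regular_rep G \<beta> f \<xi>)) \<le> C * norm (vector_square \<xi>)"
proof -
  have "\<exists>C. \<forall>\<xi>. finsupp \<xi> \<longrightarrow> finsupp (\<lambda>g. \<Sum>h\<in>S. shift_mult (f h) h \<xi> g) \<and>
      norm (vector_square (\<lambda>g. \<Sum>h\<in>S. shift_mult (f h) h \<xi> g)) \<le> C * norm (vector_square \<xi>)"
    if "finite S" "S \<subseteq> carrier G" for S
    using that
  proof (induction S)
    case empty
    then show ?case by (intro exI[of _ 0]) (simp add: gsupp_def vector_square_def)
  next
    case (insert h S)
    let ?R = "\<lambda>\<xi> g. \<Sum>h\<in>S. shift_mult (f h) h \<xi> g"
    from insert obtain C where C: "\<And>\<xi>. finsupp \<xi> \<Longrightarrow> finsupp (?R \<xi>)"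
      "\<And>\<xi>. finsupp \<xi> \<Longrightarrow> norm (vector_square (?R \<xi>)) \<le> C * norm (vector_square \<xi>)"
      by auto
    from insert have h: "h \<in> carrier G" by simp
    show ?case
    proof (intro exI allI impI conjI)
      fix \<xi> :: "'g \<Rightarrow> 'a" assume \<xi>: "finsupp \<xi>"
      note fin = shift_mult_bound(1)[OF h \<xi>, of "f h"] C(1)[OF \<xi>]
      have eq: "(\<lambda>g. \<Sum>h\<in>insert h S. shift_mult (f h) h \<xi> g)
          = (\<lambda>g. shift_mult (f h) h \<xi> g + ?R \<xi> g)"
        using insert by simp
      show "finsupp (\<lambda>g. \<Sum>h\<in>insert h S. shift_mult (f h) h \<xi> g)"
        unfolding eq by (rule vector_square_add_le(1)[OF fin])
      show "norm (vector_square (\<lambda>g. \<Sum>h\<in>insert h S. shift_mult (f h) h \<xi> g))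
          \<le> (2 * (norm (f h))\<^sup>2 + 2 * C) * norm (vector_square \<xi>)"
        unfolding eq
        using vector_square_add_le(2)[OF fin] shift_mult_bound(2)[OF h \<xi>, of "f h"] C(2)[OF \<xi>]
        by (simp add: algebra_simps)
    qed
  qed
  from this[OF assms gsupp_subset]
  obtain C where "\<forall>\<xi>. finsupp \<xi> \<longrightarrow> finsupp (regular_rep G \<beta> f \<xi>) \<and>
      norm (vector_square (regular_rep G \<beta> f \<xi>)) \<le> C * norm (vector_square \<xi>)"
    unfolding regular_rep_eq by (rule exE)
  then show thesis by (intro that[of C]) simp_all
qed

text \<open>
  Without this bound the supremum in \<^const>\<open>reduced_norm\<close> would be an arbitrary real number and could
  not be compared with any of the terms it ranges over.
\<close>

lemma bdd_above_regular_rep: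
  assumes "finsupp f"
  shows "bdd_above ((\<lambda>\<xi>. l2_norm G (regular_rep G \<beta> f \<xi>)) ` {\<xi>. finsupp \<xi> \<and> l2_norm G \<xi> \<le> 1})"
proof -
  obtain C where C: "\<And>\<xi>. finsupp \<xi> \<Longrightarrow>
      norm (vector_square (regular_rep G \<beta> f \<xi>)) \<le> C * norm (vector_square \<xi>)"
    using regular_rep_bounded[OF assms] by metis
  show ?thesis
  proof (rule bdd_aboveI2)
    fix \<xi> assume "\<xi> \<in> {\<xi> :: 'g \<Rightarrow> 'a. finsupp \<xi> \<and> l2_norm G \<xi> \<le> 1}"
    then have \<xi>: "finsupp \<xi>" "norm (vector_square \<xi>) \<le> 1" by (simp_all add: l2_norm_eq)
    have "norm (vector_square (regular_rep G \<beta> f \<xi>)) \<le> \<bar>C\<bar> * 1"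
      by (rule order_trans[OF C[OF \<xi>(1)]]) (intro mult_mono \<xi>(2), auto)
    then show "l2_norm G (regular_rep G \<beta> f \<xi>) \<le> sqrt \<bar>C\<bar>"
      by (simp add: l2_norm_eq)
  qed
qed

text \<open>
  Evaluate at the unit vector at \<open>\<one>\<close>: the inner square of its image is
  \<open>\<Sum>\<^sub>g \<beta>\<^bsub>g\<^sup>-\<^sup>1\<^esub>(f(g)\<^sup>* f(g))\<close>, which dominates the term with \<open>g = \<one>\<close>.
\<close>

lemma norm_coefficient_le_reduced_norm:
  assumes f: "finsupp f"
  shows "norm (f \<one>) \<le> reduced_norm G \<beta> f"
proof -
  let ?e = "single \<one> 1"
  have supp: "gsupp G ?e \<subseteq> {\<one>}" by (auto simp: gsupp_def single_def)
  have "vector_square ?e = 1"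
    by (subst vector_square_superset[OF _ supp]) (simp_all add: single_def)
  then have unit: "l2_norm G ?e \<le> 1" by (simp add: l2_norm_eq)
  have rep: "regular_rep G \<beta> f ?e g = \<beta> (inv g) (f g)" if g: "g \<in> carrier G" for g
  proof -
    note inv_mult_eq_one[OF _ g]
    then have delta: "shift_mult (f h) h ?e g = (if h = g then \<beta> (inv g) (f g) else 0)"
      if "h \<in> carrier G" for h
      using that by (simp add: shift_mult_def single_def)
    have F: "finite (insert g (gsupp G f))" "insert g (gsupp G f) \<subseteq> carrier G"
      using f g by (auto simp: gsupp_def)
    have "regular_rep G \<beta> f ?e g = (\<Sum>h\<in>insert g (gsupp G f). shift_mult (f h) h ?e g)"
      by (rule regular_rep_superset[OF F(1) _ F(2) g]) blast
    also have "\<dots> = (\<Sum>h\<in>insert g (gsupp G f). if h = g then \<beta> (inv g) (f g) else 0)"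
      by (rule sum.cong[OF refl], rule delta) (use F(2) in blast)
    also have "\<dots> = \<beta> (inv g) (f g)" using F(1) by simp
    finally show ?thesis .
  qed
  let ?F = "insert \<one> (gsupp G f)"
  let ?\<eta> = "\<lambda>g. \<beta> (inv g) (f g)"
  have "gsupp G ?\<eta> \<subseteq> ?F"
    by (auto simp: gsupp_def action_zero)
  then have "vector_square ?\<eta> = (\<Sum>g\<in>?F. star (?\<eta> g) * ?\<eta> g)"
    using f gsupp_subset[of f] by (intro vector_square_superset) auto
  also have "\<dots> = star (f \<one>) * f \<one> + (\<Sum>g\<in>?F - {\<one>}. star (?\<eta> g) * ?\<eta> g)"
    using f by (subst sum.remove[of _ \<one>]) (simp_all add: action_one)
  finally have "norm (star (f \<one>) * f \<one>) \<le> norm (vector_square ?\<eta>)"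
    by (simp only:) (intro positive_norm_mono positive_star_mult positive_sum)
  also have "vector_square ?\<eta> = vector_square (regular_rep G \<beta> f ?e)"
    by (rule vector_square_cong) (simp add: rep)
  finally have "(norm (f \<one>))\<^sup>2 \<le> norm (vector_square (regular_rep G \<beta> f ?e))"
    by (simp add: cstar_identity)
  then have "norm (f \<one>) \<le> l2_norm G (regular_rep G \<beta> f ?e)"
    unfolding l2_norm_eq by (rule real_le_rsqrt)
  also have "\<dots> \<le> reduced_norm G \<beta> f"
    unfolding reduced_norm_def
    by (rule cSUP_upper[OF _ bdd_above_regular_rep[OF f]]) (simp add: finsupp_single unit)
  finally show ?thesis .
qed

lemma reduced_norm_le:
  assumes "\<And>\<xi>. finsupp \<xi> \<Longrightarrow> norm (vector_square \<xi>) \<le> 1 \<Longrightarrow>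
      norm (vector_square (regular_rep G \<beta> f \<xi>)) \<le> r\<^sup>2" and "0 \<le> r"
  shows "reduced_norm G \<beta> f \<le> r"
  unfolding reduced_norm_def
proof (rule cSUP_least)
  have "(\<lambda>_. 0) \<in> {\<xi> :: 'g \<Rightarrow> 'a. finsupp \<xi> \<and> l2_norm G \<xi> \<le> 1}"
    by (simp add: l2_norm_def gsupp_def)
  then show "{\<xi> :: 'g \<Rightarrow> 'a. finsupp \<xi> \<and> l2_norm G \<xi> \<le> 1} \<noteq> {}" by blast
next
  fix \<xi> assume "\<xi> \<in> {\<xi> :: 'g \<Rightarrow> 'a. finsupp \<xi> \<and> l2_norm G \<xi> \<le> 1}"
  then show "l2_norm G (regular_rep G \<beta> f \<xi>) \<le> r"
    using assms by (auto simp: l2_norm_eq intro!: real_le_lsqrt)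
qed

lemma reduced_norm_single_one: "reduced_norm G \<beta> (single \<one> a) \<le> norm a"
proof (rule reduced_norm_le)
  fix \<xi> :: "'g \<Rightarrow> 'a" assume \<xi>: "finsupp \<xi>" "norm (vector_square \<xi>) \<le> 1"
  have "vector_square (regular_rep G \<beta> (single \<one> a) \<xi>) = vector_square (shift_mult a \<one> \<xi>)"
    by (rule vector_square_cong, subst regular_rep_superset[of "{\<one>}"])
       (auto simp: gsupp_def single_def)
  then show "norm (vector_square (regular_rep G \<beta> (single \<one> a) \<xi>)) \<le> (norm a)\<^sup>2"
    using shift_mult_bound(2)[OF one_closed \<xi>(1), of a] mult_left_mono[OF \<xi>(2), of "(norm a)\<^sup>2"]
    by simp
qed simp

end

section \<open>The canonical expectation\<close>

locale reduced_crossed_system = cstar_dynamical_system \<tau> G \<beta>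
  for \<tau> :: "'a::unital_cstar_algebra \<Rightarrow> complex" and G :: "('g, 'm) monoid_scheme" (structure)
    and \<beta> :: "'g \<Rightarrow> 'a \<Rightarrow> 'a" +
  fixes \<iota> :: "'a \<Rightarrow> 'b::unital_cstar_algebra" and u :: "'g \<Rightarrow> 'b"
  assumes invariant: "g \<in> carrier G \<Longrightarrow> \<tau> (\<beta> g a) = \<tau> a"
    and crossed: "reduced_crossed_product G \<beta> \<iota> u"
begin

lemma embed_add: "\<iota> (a + b) = \<iota> a + \<iota> b"
  and embed_scaleC: "\<iota> (c *\<^sub>C a) = c *\<^sub>C \<iota> a"
  and embed_one: "\<iota> 1 = 1"
  and embed_mult: "\<iota> (a * b) = \<iota> a * \<iota> b"
  and embed_star: "\<iota> (star a) = star (\<iota> a)"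
  using crossed unfolding reduced_crossed_product_def star_hom_def clinear_iff by simp_all

lemma embed_zero: "\<iota> 0 = 0"
  using embed_add[of 0 0] by simp

lemma embed_diff: "\<iota> (a - b) = \<iota> a - \<iota> b"
  using embed_add[of "a - b" b] by simp

lemma unitary_left: "g \<in> carrier G \<Longrightarrow> star (u g) * u g = 1"
  and unitary_mult: "g \<in> carrier G \<Longrightarrow> h \<in> carrier G \<Longrightarrow> u (g \<otimes> h) = u g * u h"
  and covariance: "g \<in> carrier G \<Longrightarrow> u g * \<iota> a * star (u g) = \<iota> (\<beta> g a)"
  using crossed unfolding reduced_crossed_product_def unitary_def by auto

lemma unitary_one: "u \<one> = 1"
proof -
  have "u \<one> * u \<one> = u \<one>" using unitary_mult[of \<one> \<one>] by simp
  then have "star (u \<one>) * u \<one> * u \<one> = star (u \<one>) * u \<one>" by (simp add: mult.assoc)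
  then show ?thesis by (simp add: unitary_left)
qed

lemma star_unitary:
  assumes g: "g \<in> carrier G"
  shows "star (u g) = u (inv g)"
proof -
  have "star (u g) = star (u g) * (u g * u (inv g))"
    using g by (simp add: unitary_one flip: unitary_mult)
  also have "\<dots> = u (inv g)"
    using g by (simp add: unitary_left flip: mult.assoc)
  finally show ?thesis .
qed

lemma unitary_embed:
  assumes g: "g \<in> carrier G"
  shows "u g * \<iota> a = \<iota> (\<beta> g a) * u g"
proof -
  have "u g * \<iota> a = u g * \<iota> a * (star (u g) * u g)"
    by (simp add: unitary_left g)
  also have "\<dots> = \<iota> (\<beta> g a) * u g"
    by (simp add: g flip: mult.assoc covariance)
  finally show ?thesis .
qed

lemma crossed_sum_superset:
  "finite F \<Longrightarrow> gsupp G f \<subseteq> F \<Longrightarrow> F \<subseteq> carrier G \<Longrightarrow>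
     crossed_sum G \<iota> u f = (\<Sum>g\<in>F. \<iota> (f g) * u g)"
  unfolding crossed_sum_def by (rule sum_gsupp) (simp_all add: embed_zero)

lemma crossed_sum_add:
  assumes "finsupp f" "finsupp f'"
  shows "crossed_sum G \<iota> u (\<lambda>g. f g + f' g) = crossed_sum G \<iota> u f + crossed_sum G \<iota> u f'"
proof -
  let ?F = "gsupp G f \<union> gsupp G f'"
  have F: "finite ?F" "?F \<subseteq> carrier G" using assms by (auto simp: gsupp_def)
  have "gsupp G (\<lambda>g. f g + f' g) \<subseteq> ?F" by (auto simp: gsupp_def)
  from crossed_sum_superset[OF F(1) this F(2)]
    crossed_sum_superset[OF F(1) Un_upper1 F(2)] crossed_sum_superset[OF F(1) Un_upper2 F(2)]
  show ?thesis by (simp add: embed_add distrib_right sum.distrib)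
qed

lemma crossed_sum_scaleC:
  assumes "finsupp f"
  shows "finsupp (\<lambda>g. c *\<^sub>C f g)"
    and "crossed_sum G \<iota> u (\<lambda>g. c *\<^sub>C f g) = c *\<^sub>C crossed_sum G \<iota> u f"
proof -
  have sub: "gsupp G (\<lambda>g. c *\<^sub>C f g) \<subseteq> gsupp G f"
    by (auto simp: gsupp_def)
  then show "finsupp (\<lambda>g. c *\<^sub>C f g)" using assms finite_subset by blast
  show "crossed_sum G \<iota> u (\<lambda>g. c *\<^sub>C f g) = c *\<^sub>C crossed_sum G \<iota> u f"
    unfolding crossed_sum_superset[OF assms sub gsupp_subset]
    unfolding crossed_sum_def cvec.scale_sum_right
    by (simp add: embed_scaleC mult_scaleC_left)
qed

lemma crossed_sum_diff:
  assumes "finsupp f" "finsupp f'"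
  shows "finsupp (\<lambda>g. f g - f' g)"
    and "crossed_sum G \<iota> u (\<lambda>g. f g - f' g) = crossed_sum G \<iota> u f - crossed_sum G \<iota> u f'"
proof -
  let ?F = "gsupp G f \<union> gsupp G f'"
  have F: "finite ?F" "?F \<subseteq> carrier G" using assms by (auto simp: gsupp_def)
  have sub: "gsupp G (\<lambda>g. f g - f' g) \<subseteq> ?F" by (auto simp: gsupp_def)
  then show fin: "finsupp (\<lambda>g. f g - f' g)" using F(1) finite_subset by blast
  from crossed_sum_superset[OF F(1) sub F(2)]
    crossed_sum_superset[OF F(1) Un_upper1 F(2)] crossed_sum_superset[OF F(1) Un_upper2 F(2)]
  show "crossed_sum G \<iota> u (\<lambda>g. f g - f' g) = crossed_sum G \<iota> u f - crossed_sum G \<iota> u f'"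
    by (simp add: embed_diff left_diff_distrib sum_subtractf)
qed

lemma crossed_sum_single: "g \<in> carrier G \<Longrightarrow> crossed_sum G \<iota> u (single g a) = \<iota> a * u g"
  by (subst crossed_sum_superset[of "{g}"]) (auto simp: gsupp_def single_def)

definition algebraic :: "'b set" where
  "algebraic = crossed_sum G \<iota> u ` {f. finsupp f}"

lemma closure_algebraic: "closure algebraic = UNIV"
  and norm_crossed_sum: "finsupp f \<Longrightarrow> norm (crossed_sum G \<iota> u f) = reduced_norm G \<beta> f"
  using crossed unfolding reduced_crossed_product_def algebraic_def by auto

lemma algebraic_seq:
  "\<exists>d. (\<forall>n. d n \<in> algebraic) \<and> d \<longlonglongrightarrow> x"
  using closure_algebraic closure_sequential[of x algebraic] by auto

text \<open>
  Identities for the expectation are checked on monomials and extended by additivity and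
  sequential continuity.
\<close>

lemma additive_eq_on_dense:
  fixes P Q :: "'b \<Rightarrow> 'c::{t2_space, monoid_add}"
  assumes zero: "P 0 = 0" "Q 0 = 0"
    and add: "\<And>x y. P (x + y) = P x + P y" "\<And>x y. Q (x + y) = Q x + Q y"
    and cont: "\<And>(d :: nat \<Rightarrow> 'b) x. d \<longlonglongrightarrow> x \<Longrightarrow> (\<lambda>n. P (d n)) \<longlonglongrightarrow> P x"
      "\<And>(d :: nat \<Rightarrow> 'b) x. d \<longlonglongrightarrow> x \<Longrightarrow> (\<lambda>n. Q (d n)) \<longlonglongrightarrow> Q x"
    and generators: "\<And>a g. g \<in> carrier G \<Longrightarrow> P (\<iota> a * u g) = Q (\<iota> a * u g)"
  shows "P x = Q x"
proof -
  have "P (\<Sum>g\<in>S. \<iota> (f g) * u g) = Q (\<Sum>g\<in>S. \<iota> (f g) * u g)" if "S \<subseteq> carrier G" for S and f :: "'g \<Rightarrow> 'a"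
    using that by (induction S rule: infinite_finite_induct) (simp_all add: zero add generators)
  then have eq: "P d = Q d" if "d \<in> algebraic" for d
    using that unfolding algebraic_def crossed_sum_def by (auto simp: gsupp_subset)
  obtain d where d: "\<And>n. d n \<in> algebraic" "d \<longlonglongrightarrow> x" using algebraic_seq[of x] by auto
  show ?thesis
    using LIMSEQ_unique[OF cont(1)[OF d(2)]] cont(2)[OF d(2)] eq[OF d(1)] by simp
qed

lemma canonical_expectation_exists:
  "\<exists>!E. Vector_Spaces.linear scaleC scaleC E \<and> continuous_on UNIV E \<and>
        (\<forall>f. finsupp f \<longrightarrow> E (crossed_sum G \<iota> u f) = f \<one>)"
proof -
  define E\<^sub>0 where "E\<^sub>0 d = (SOME f. finsupp f \<and> crossed_sum G \<iota> u f = d) \<one>" for d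
  \<comment> \<open>This inequality gives both independence of the representing function and the Lipschitz bound.\<close>
  have dist: "norm (f \<one> - f' \<one>) \<le> norm (crossed_sum G \<iota> u f - crossed_sum G \<iota> u f')"
    if "finsupp f" "finsupp f'" for f f' :: "'g \<Rightarrow> 'a"
    using norm_coefficient_le_reduced_norm[OF crossed_sum_diff(1)[OF that]]
    by (simp add: crossed_sum_diff that flip: norm_crossed_sum)
  have E\<^sub>0: "E\<^sub>0 (crossed_sum G \<iota> u f) = f \<one>" if "finsupp f" for f
  proof -
    let ?f = "SOME f'. finsupp f' \<and> crossed_sum G \<iota> u f' = crossed_sum G \<iota> u f"
    have "finsupp ?f \<and> crossed_sum G \<iota> u ?f = crossed_sum G \<iota> u f"
      by (rule someI[of _ f]) (use that in simp)
    with dist[of ?f f] that show ?thesis by (simp add: E\<^sub>0_def)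
  qed
  have "1-lipschitz_on algebraic E\<^sub>0"
    by (rule lipschitz_onI) (use dist in \<open>auto simp: algebraic_def E\<^sub>0 dist_norm\<close>)
  then obtain E where "1-lipschitz_on UNIV E" and E_alg: "\<And>d. d \<in> algebraic \<Longrightarrow> E d = E\<^sub>0 d"
    using lipschitz_extend_closure[of 1 algebraic E\<^sub>0] closure_algebraic by auto
  then have cont: "continuous_on UNIV E"
    by (intro lipschitz_on_continuous_on)
  have lim: "(\<lambda>n. E (d n)) \<longlonglongrightarrow> E x" if "d \<longlonglongrightarrow> x" for d x
    using continuous_on_tendsto_compose[OF cont that] by simp
  have E: "E (crossed_sum G \<iota> u f) = f \<one>" if "finsupp f" for f
  proof -
    have "crossed_sum G \<iota> u f \<in> algebraic"
      unfolding algebraic_def by (rule imageI) (simp add: that)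
    then show ?thesis by (simp only: E_alg E\<^sub>0[OF that])
  qed
  have E_add: "E (x + y) = E x + E y" for x y
  proof -
    obtain d where d: "\<And>n. d n \<in> algebraic" "d \<longlonglongrightarrow> x" using algebraic_seq[of x] by auto
    obtain e where e: "\<And>n. e n \<in> algebraic" "e \<longlonglongrightarrow> y" using algebraic_seq[of y] by auto
    have "E (d n + e n) = E (d n) + E (e n)" for n
    proof -
      obtain f f' where f: "finsupp f" "finsupp f'" "d n = crossed_sum G \<iota> u f" "e n = crossed_sum G \<iota> u f'"
        using d(1)[of n] e(1)[of n] unfolding algebraic_def by blast
      then show ?thesis
        using E[OF vector_square_add_le(1)[OF f(1,2)]] by (simp add: crossed_sum_add E)
    qed
    then show ?thesis
      using LIMSEQ_unique[OF lim[OF tendsto_add[OF d(2) e(2)]]] tendsto_add[OF lim[OF d(2)] lim[OF e(2)]]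
      by simp
  qed
  have E_scaleC: "E (c *\<^sub>C x) = c *\<^sub>C E x" for c x
  proof -
    obtain d where d: "\<And>n. d n \<in> algebraic" "d \<longlonglongrightarrow> x" using algebraic_seq[of x] by auto
    have "E (c *\<^sub>C d n) = c *\<^sub>C E (d n)" for n
    proof -
      obtain f where "finsupp f" "d n = crossed_sum G \<iota> u f"
        using d(1)[of n] unfolding algebraic_def by blast
      then show ?thesis using E[OF crossed_sum_scaleC(1)[of f c]] by (simp add: crossed_sum_scaleC E)
    qed
    then show ?thesis
      using LIMSEQ_unique[OF lim[OF tendsto_scaleC[OF d(2), of c]]] tendsto_scaleC[OF lim[OF d(2)], of c]
      by simp
  qed
  show ?thesis
  proof (rule ex1I[of _ E])
    show "Vector_Spaces.linear scaleC scaleC E \<and> continuous_on UNIV E \<and>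
        (\<forall>f. finsupp f \<longrightarrow> E (crossed_sum G \<iota> u f) = f \<one>)"
      using E_add E_scaleC cont E by (simp add: clinear_iff)
  next
    fix E' assume E': "Vector_Spaces.linear scaleC scaleC E' \<and> continuous_on UNIV E' \<and>
        (\<forall>f. finsupp f \<longrightarrow> E' (crossed_sum G \<iota> u f) = f \<one>)"
    show "E' = E"
    proof
      fix x
      obtain d where d: "\<And>n. d n \<in> algebraic" "d \<longlonglongrightarrow> x" using algebraic_seq[of x] by auto
      have "E' (d n) = E (d n)" for n using d(1)[of n] E' E by (auto simp: algebraic_def)
      moreover have "(\<lambda>n. E' (d n)) \<longlonglongrightarrow> E' x"
        using continuous_on_tendsto_compose[OF _ d(2), of UNIV E'] E' by simp
      ultimately show "E' x = E x" using LIMSEQ_unique[OF _ lim[OF d(2)]] by simp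
    qed
  qed
qed

definition expectation :: "'b \<Rightarrow> 'a" where
  "expectation = canonical_expectation G \<iota> u"

lemma expectation_props:
  "Vector_Spaces.linear scaleC scaleC expectation \<and> continuous_on UNIV expectation \<and>
     (\<forall>f. finsupp f \<longrightarrow> expectation (crossed_sum G \<iota> u f) = f \<one>)"
  unfolding expectation_def canonical_expectation_def
  by (rule theI'[OF canonical_expectation_exists])

lemma expectation_add: "expectation (x + y) = expectation x + expectation y"
  and expectation_scaleC: "expectation (c *\<^sub>C x) = c *\<^sub>C expectation x"
  and expectation_crossed_sum: "finsupp f \<Longrightarrow> expectation (crossed_sum G \<iota> u f) = f \<one>"
  using expectation_props by (auto simp: clinear_iff)

lemma tendsto_expectation [tendsto_intros]:
  "(f \<longlongrightarrow> x) F \<Longrightarrow> ((\<lambda>i. expectation (f i)) \<longlongrightarrow> expectation x) F"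
  using continuous_on_tendsto_compose[of UNIV expectation f x F] expectation_props by simp

lemma expectation_zero: "expectation 0 = 0"
  using expectation_add[of 0 0] by simp

lemma expectation_scaleR: "expectation (r *\<^sub>R x) = r *\<^sub>R expectation x"
  by (simp add: expectation_scaleC flip: scaleC_of_real)

lemma expectation_sum: "expectation (sum w S) = (\<Sum>i\<in>S. expectation (w i))"
  by (induction S rule: infinite_finite_induct) (simp_all add: expectation_zero expectation_add)

lemma expectation_monomial:
  assumes "g \<in> carrier G"
  shows "expectation (\<iota> a * u g * \<iota> b) = (if g = \<one> then a * b else 0)"
proof -
  have "\<iota> a * u g * \<iota> b = crossed_sum G \<iota> u (single g (a * \<beta> g b))"
    using assms by (simp add: crossed_sum_single embed_mult mult.assoc unitary_embed)
  then show ?thesis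
    by (simp add: expectation_crossed_sum finsupp_single single_def action_one)
qed

lemma expectation_generator:
  "g \<in> carrier G \<Longrightarrow> expectation (\<iota> a * u g) = (if g = \<one> then a else 0)"
  using expectation_monomial[of g a 1] by (simp add: embed_one)

lemma expectation_embed_conj:
  "expectation (star (\<iota> a) * x * \<iota> a) = star a * expectation x * a"
proof (rule additive_eq_on_dense[where x = x])
  fix b g assume g: "g \<in> carrier G"
  show "expectation (star (\<iota> a) * (\<iota> b * u g) * \<iota> a) = star a * expectation (\<iota> b * u g) * a"
    using expectation_monomial[OF g, of "star a * b" a]
    by (simp add: expectation_generator g embed_mult embed_star mult.assoc)
qed (auto simp: expectation_zero expectation_add distrib_left distrib_right intro!: tendsto_intros)

text \<open>
  Conjugation by \<open>u g\<close> acts on the coefficient at \<open>\<one>\<close> as the inverse of \<open>\<beta> g\<close>, which \<open>\<tau>\<close> does not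
  see. After \<open>\<tau>\<close> has been applied, both sides are continuous in \<open>x\<close>.
\<close>

lemma state_expectation_unitary_conj:
  assumes g: "g \<in> carrier G"
  shows "\<tau> (expectation (star (u g) * x * u g)) = \<tau> (expectation x)"
proof (rule additive_eq_on_dense[where x = x])
  fix a h assume h: "h \<in> carrier G"
  have "star (u g) * (\<iota> a * u h) * u g = u (inv g) * \<iota> a * u h * u g"
    by (simp add: star_unitary g mult.assoc)
  also have "\<dots> = \<iota> (\<beta> (inv g) a) * u (inv g \<otimes> h \<otimes> g)"
    using g h by (simp add: unitary_embed unitary_mult mult.assoc)
  finally have eq: "star (u g) * (\<iota> a * u h) * u g = \<iota> (\<beta> (inv g) a) * u (inv g \<otimes> h \<otimes> g)" .
  have "inv g \<otimes> h \<otimes> g = \<one> \<longleftrightarrow> h = \<one>"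
  proof
    assume "inv g \<otimes> h \<otimes> g = \<one>"
    then have "inv g \<otimes> h = inv g" using g h by (metis inv_closed inv_equality inv_inv m_closed)
    then show "h = \<one>" using g h by simp
  qed (simp add: g)
  then show "\<tau> (expectation (star (u g) * (\<iota> a * u h) * u g)) = \<tau> (expectation (\<iota> a * u h))"
    unfolding eq using g h by (simp add: expectation_generator invariant)
next
  have "\<tau> 0 = 0" using state_add[of 0 0] by simp
  then show "\<tau> (expectation (star (u g) * 0 * u g)) = 0" "\<tau> (expectation 0) = 0"
    by (simp_all add: expectation_zero)
qed (auto simp: expectation_add state_add distrib_left distrib_right intro!: tendsto_intros)

section \<open>Faithfulness of the extended state\<close>

text \<open>
  The unitaries stand on the left, unlike in \<^const>\<open>crossed_sum\<close>: this makes
  \<open>\<xi> \<mapsto> module_vec \<xi>\<close> an isometry of right modules for the inner product \<open>E(v\<^sup>* w)\<close> and turns the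
  regular representation into left multiplication.
\<close>

definition module_vec :: "('g \<Rightarrow> 'a) \<Rightarrow> 'b" where
  "module_vec \<xi> = (\<Sum>g\<in>gsupp G \<xi>. u g * \<iota> (\<xi> g))"

lemma module_vec_superset:
  "finite F \<Longrightarrow> gsupp G \<xi> \<subseteq> F \<Longrightarrow> F \<subseteq> carrier G \<Longrightarrow> module_vec \<xi> = (\<Sum>g\<in>F. u g * \<iota> (\<xi> g))"
  unfolding module_vec_def by (rule sum_gsupp) (simp_all add: embed_zero)

lemma crossed_sum_eq_vec:
  assumes "finsupp f"
  obtains \<xi> where "finsupp \<xi>" "crossed_sum G \<iota> u f = module_vec \<xi>"
proof
  let ?\<xi> = "\<lambda>g. \<beta> (inv g) (f g)"
  have sub: "gsupp G ?\<xi> \<subseteq> gsupp G f" by (auto simp: gsupp_def action_zero)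
  then show "finsupp ?\<xi>" using assms finite_subset by blast
  show "crossed_sum G \<iota> u f = module_vec ?\<xi>"
    unfolding module_vec_superset[OF assms sub gsupp_subset] crossed_sum_def
    by (rule sum.cong) (auto simp: gsupp_def unitary_embed action_inv)
qed

lemma expectation_vec_square:
  assumes "finsupp \<xi>"
  shows "expectation (star (module_vec \<xi>) * module_vec \<xi>) = vector_square \<xi>"
proof -
  have "star (module_vec \<xi>) * module_vec \<xi>
      = (\<Sum>g\<in>gsupp G \<xi>. \<Sum>h\<in>gsupp G \<xi>. \<iota> (star (\<xi> g)) * u (inv g \<otimes> h) * \<iota> (\<xi> h))"
    unfolding module_vec_def star_sum sum_product
    by (intro sum.cong refl)
       (auto simp: gsupp_def star_mult embed_star star_unitary unitary_mult mult.assoc)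
  also have "expectation \<dots> = (\<Sum>g\<in>gsupp G \<xi>. \<Sum>h\<in>gsupp G \<xi>. if h = g then star (\<xi> g) * \<xi> h else 0)"
    unfolding expectation_sum
  proof (intro sum.cong refl)
    fix g h assume "g \<in> gsupp G \<xi>" "h \<in> gsupp G \<xi>"
    then have gh: "g \<in> carrier G" "h \<in> carrier G" by (auto simp: gsupp_def)
    then have "inv g \<otimes> h = \<one> \<longleftrightarrow> h = g" by (auto simp: inv_mult_eq_one)
    with gh show "expectation (\<iota> (star (\<xi> g)) * u (inv g \<otimes> h) * \<iota> (\<xi> h))
        = (if h = g then star (\<xi> g) * \<xi> h else 0)"
      by (simp add: expectation_monomial)
  qed
  finally show ?thesis using assms by (simp add: vector_square_def)
qed

lemma module_vec_shift_mult:
  assumes h: "h \<in> carrier G" and \<xi>: "finsupp \<xi>"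
  shows "module_vec (shift_mult a h \<xi>) = \<iota> a * u h * module_vec \<xi>"
proof -
  have inj: "inj_on (\<lambda>k. h \<otimes> k) (gsupp G \<xi>)"
    by (rule inj_on_translate[OF h])
  have "module_vec (shift_mult a h \<xi>) = (\<Sum>g\<in>(\<lambda>k. h \<otimes> k) ` gsupp G \<xi>. u g * \<iota> (shift_mult a h \<xi> g))"
    using h \<xi> by (intro module_vec_superset gsupp_shift_mult) (auto simp: gsupp_def)
  also have "\<dots> = (\<Sum>k\<in>gsupp G \<xi>. \<iota> a * u h * (u k * \<iota> (\<xi> k)))"
    unfolding sum.reindex[OF inj] o_def
  proof (rule sum.cong)
    fix k assume "k \<in> gsupp G \<xi>"
    then have k: "k \<in> carrier G" by (simp add: gsupp_def)
    with h have "shift_mult a h \<xi> (h \<otimes> k) = \<beta> (inv (h \<otimes> k)) a * \<xi> k"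
      by (simp add: shift_mult_def flip: m_assoc)
    moreover have "u (h \<otimes> k) * \<iota> (\<beta> (inv (h \<otimes> k)) a) = \<iota> a * u (h \<otimes> k)"
      using h k by (simp add: unitary_embed action_inv del: inv_mult_group)
    ultimately show "u (h \<otimes> k) * \<iota> (shift_mult a h \<xi> (h \<otimes> k)) = \<iota> a * u h * (u k * \<iota> (\<xi> k))"
      using h k by (simp add: embed_mult unitary_mult flip: mult.assoc)
  qed simp
  finally show ?thesis by (simp add: module_vec_def sum_distrib_left)
qed

lemma module_vec_regular_rep:
  assumes f: "finsupp f" and \<xi>: "finsupp \<xi>"
  shows "module_vec (regular_rep G \<beta> f \<xi>) = crossed_sum G \<iota> u f * module_vec \<xi>"
proof -
  let ?F = "\<Union>h\<in>gsupp G f. gsupp G (shift_mult (f h) h \<xi>)"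
  have F: "finite ?F" "?F \<subseteq> carrier G"
    using f shift_mult_bound(1)[OF _ \<xi>] gsupp_subset by (auto simp: gsupp_def)
  have "gsupp G (regular_rep G \<beta> f \<xi>) \<subseteq> ?F"
  proof
    fix g assume g: "g \<in> gsupp G (regular_rep G \<beta> f \<xi>)"
    then have "(\<Sum>h\<in>gsupp G f. shift_mult (f h) h \<xi> g) \<noteq> 0"
      unfolding regular_rep_eq by (simp add: gsupp_def)
    then obtain h where "h \<in> gsupp G f" "shift_mult (f h) h \<xi> g \<noteq> 0"
      by (rule sum.not_neutral_contains_not_neutral)
    with g show "g \<in> ?F" by (auto simp: gsupp_def)
  qed
  then have "module_vec (regular_rep G \<beta> f \<xi>) = (\<Sum>g\<in>?F. u g * \<iota> (regular_rep G \<beta> f \<xi> g))"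
    using F by (intro module_vec_superset)
  also have "\<dots> = (\<Sum>g\<in>?F. \<Sum>h\<in>gsupp G f. u g * \<iota> (shift_mult (f h) h \<xi> g))"
  proof -
    have "\<iota> (sum w S) = (\<Sum>i\<in>S. \<iota> (w i))" for w and S :: "'g set"
      by (induction S rule: infinite_finite_induct) (simp_all add: embed_zero embed_add)
    then show ?thesis by (simp add: regular_rep_eq sum_distrib_left)
  qed
  also have "\<dots> = (\<Sum>h\<in>gsupp G f. \<Sum>g\<in>?F. u g * \<iota> (shift_mult (f h) h \<xi> g))"
    by (rule sum.swap)
  also have "\<dots> = (\<Sum>h\<in>gsupp G f. module_vec (shift_mult (f h) h \<xi>))"
    by (intro sum.cong refl module_vec_superset[symmetric] F) auto
  also have "\<dots> = (\<Sum>h\<in>gsupp G f. \<iota> (f h) * u h * module_vec \<xi>)"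
    by (intro sum.cong refl module_vec_shift_mult \<xi>) (auto simp: gsupp_def)
  finally show ?thesis by (simp add: crossed_sum_def sum_distrib_right)
qed

text \<open>
  The inner square of \<open>y\<close> in the Hilbert module obtained by completing the crossed product with
  respect to the expectation.
\<close>

definition gram :: "'b \<Rightarrow> 'a" where
  "gram y = expectation (star y * y)"

lemma positive_gram: "positive (gram y)"
proof -
  obtain d where d: "\<And>n. d n \<in> algebraic" "d \<longlonglongrightarrow> y" using algebraic_seq[of y] by auto
  have "positive (gram (d n))" for n
  proof -
    obtain f where f: "finsupp f" "d n = crossed_sum G \<iota> u f"
      using d(1)[of n] unfolding algebraic_def by blast
    obtain \<xi> where "finsupp \<xi>" "crossed_sum G \<iota> u f = module_vec \<xi>"
      by (rule crossed_sum_eq_vec[OF f(1)])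
    with f(2) show ?thesis by (simp add: gram_def expectation_vec_square positive_vector_square)
  qed
  moreover have "(\<lambda>n. gram (d n)) \<longlonglongrightarrow> gram y"
    unfolding gram_def by (intro tendsto_intros d)
  ultimately show ?thesis by (rule positive_limit[rotated])
qed

lemma gram_add_le: "norm (gram (y + z)) \<le> 2 * norm (gram y) + 2 * norm (gram z)"
proof -
  have "star (y + z) * (y + z) + star (y - z) * (y - z) = 2 *\<^sub>R (star y * y) + 2 *\<^sub>R (star z * z)"
    by (simp add: star_add star_diff algebra_simps scaleR_2)
  then have "gram (y + z) + gram (y - z) = 2 *\<^sub>R gram y + 2 *\<^sub>R gram z"
    unfolding gram_def by (simp flip: expectation_add expectation_scaleR)
  then have "norm (gram (y + z)) \<le> norm (2 *\<^sub>R gram y + 2 *\<^sub>R gram z)"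
    using positive_norm_mono[OF positive_gram positive_gram] by metis
  also have "\<dots> \<le> 2 * norm (gram y) + 2 * norm (gram z)"
    by (rule order_trans[OF norm_triangle_ineq]) simp
  finally show ?thesis .
qed

text \<open>
  Write \<open>(norm z)\<^sup>2 - z\<^sup>* z = b\<^sup>2\<close> in the crossed product; then
  \<open>gram (z * w) + gram (b * w) = (norm z)\<^sup>2 gram w\<close>, and monotonicity applies in \<open>A\<close>.
\<close>

lemma gram_mult_le: "norm (gram (z * w)) \<le> (norm z)\<^sup>2 * norm (gram w)"
proof -
  have "star (star z * z) = star z * z" "norm (star z * z) \<le> (norm z)\<^sup>2"
    by (simp_all add: star_mult star_star cstar_identity)
  then obtain b where b: "star b = b" "b * b = (norm z)\<^sup>2 *\<^sub>R 1 - star z * z"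
    by (rule scalar_minus_has_sqrt)
  have "star (z * w) * (z * w) + star (b * w) * (b * w) = star w * (star z * z + b * b) * w"
    by (simp add: star_mult b(1) distrib_left distrib_right mult.assoc)
  then have "gram (z * w) + gram (b * w) = (norm z)\<^sup>2 *\<^sub>R gram w"
    unfolding gram_def by (simp add: b(2) flip: expectation_add expectation_scaleR)
  then have "norm (gram (z * w)) \<le> norm ((norm z)\<^sup>2 *\<^sub>R gram w)"
    using positive_norm_mono[OF positive_gram positive_gram] by metis
  then show ?thesis by simp
qed

text \<open>
  A null element \<open>x\<close> annihilates all vectors, so an algebraic element \<open>d\<close> acts on them as \<open>d - x\<close>
  does, with norm at most \<open>2 * norm (d - x)\<close>. As the norm of \<open>d\<close> is its norm as an operator on vectors,
  \<open>d\<close> tends to \<open>0\<close> when it tends to \<open>x\<close>.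
\<close>

lemma gram_faithful:
  assumes "\<tau> (gram x) = 0"
  shows "x = 0"
proof -
  have null_generator: "gram (x * (u g * \<iota> a)) = 0" if g: "g \<in> carrier G" for g a
  proof -
    have "gram (x * u g) = expectation (star (u g) * (star x * x) * u g)"
      by (simp add: gram_def star_mult mult.assoc)
    then have "\<tau> (gram (x * u g)) = 0"
      using state_expectation_unitary_conj[OF g, of "star x * x"] assms by (simp add: gram_def)
    then have "gram (x * u g) = 0" using positive_gram positive_state_zero by blast
    moreover have "gram (x * (u g * \<iota> a)) = star a * gram (x * u g) * a"
      using expectation_embed_conj[of a "star (x * u g) * (x * u g)"]
      by (simp add: gram_def star_mult mult.assoc)
    ultimately show ?thesis by simp
  qed
  have null_sum: "gram (x * (\<Sum>g\<in>S. u g * \<iota> (\<xi> g))) = 0" if "S \<subseteq> carrier G" for S \<xi>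
    using that
  proof (induction S rule: infinite_finite_induct)
    case (insert g S)
    then have "gram (x * (u g * \<iota> (\<xi> g))) = 0" "gram (x * (\<Sum>g\<in>S. u g * \<iota> (\<xi> g))) = 0"
      by (auto intro: null_generator)
    with insert gram_add_le[of "x * (u g * \<iota> (\<xi> g))" "x * (\<Sum>g\<in>S. u g * \<iota> (\<xi> g))"]
    show ?case by (simp add: distrib_left)
  qed (simp_all add: gram_def expectation_zero)
  have null: "gram (x * module_vec \<xi>) = 0" for \<xi>
    unfolding module_vec_def by (rule null_sum[OF gsupp_subset])
  have bound: "norm d \<le> 2 * norm (d - x)" if d: "d \<in> algebraic" for d
  proof -
    obtain f where f: "finsupp f" "d = crossed_sum G \<iota> u f"
      using d unfolding algebraic_def by blast
    have "reduced_norm G \<beta> f \<le> 2 * norm (d - x)"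
    proof (rule reduced_norm_le)
      fix \<xi> :: "'g \<Rightarrow> 'a" assume \<xi>: "finsupp \<xi>" "norm (vector_square \<xi>) \<le> 1"
      have "finsupp (regular_rep G \<beta> f \<xi>)"
        by (rule regular_rep_bounded[OF f(1)]) (simp add: \<xi>(1))
      then have "vector_square (regular_rep G \<beta> f \<xi>) = gram (d * module_vec \<xi>)"
        by (simp add: gram_def f module_vec_regular_rep \<xi>(1) flip: expectation_vec_square)
      also have "d * module_vec \<xi> = x * module_vec \<xi> + (d - x) * module_vec \<xi>"
        by (simp add: algebra_simps)
      also have "norm (gram \<dots>) \<le> 2 * norm (gram ((d - x) * module_vec \<xi>))"
        using gram_add_le[of "x * module_vec \<xi>" "(d - x) * module_vec \<xi>"] by (simp add: null)
      also have "\<dots> \<le> 2 * ((norm (d - x))\<^sup>2 * norm (vector_square \<xi>))"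
        using gram_mult_le[of "d - x" "module_vec \<xi>"] by (simp add: gram_def expectation_vec_square \<xi>(1))
      also have "\<dots> \<le> 2 * ((norm (d - x))\<^sup>2 * 1)"
        by (intro mult_left_mono \<xi>(2)) auto
      also have "\<dots> \<le> (2 * norm (d - x))\<^sup>2"
        by (simp add: power_mult_distrib)
      finally show "norm (vector_square (regular_rep G \<beta> f \<xi>)) \<le> (2 * norm (d - x))\<^sup>2" .
    qed simp
    then show ?thesis by (simp add: f norm_crossed_sum)
  qed
  obtain d where d: "\<And>n. d n \<in> algebraic" "d \<longlonglongrightarrow> x" using algebraic_seq[of x] by auto
  have "(\<lambda>n. norm (d n)) \<longlonglongrightarrow> norm x"
    by (intro tendsto_intros d(2))
  moreover have "(\<lambda>n. 2 * norm (d n - x)) \<longlonglongrightarrow> 2 * norm (x - x)"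
    by (intro tendsto_intros d(2))
  ultimately have "norm x \<le> 2 * norm (x - x)"
    by (rule LIMSEQ_le) (use bound d(1) in blast)
  then show ?thesis by simp
qed

lemma faithful_state_expectation: "faithful_state (\<lambda>x. \<tau> (expectation x))"
  unfolding faithful_state_def cfunctional_iff
proof (intro conjI allI impI)
  show "\<tau> (expectation 1) = 1"
    using expectation_generator[of \<one> 1] by (simp add: embed_one unitary_one state_one)
  show "\<tau> (expectation (star a * a)) \<in> \<real>\<^sub>\<ge>\<^sub>0" for a
    using state_positive[OF positive_gram[of a]] by (simp add: gram_def)
  show "a = 0" if "\<tau> (expectation (star a * a)) = 0" for a
    using gram_faithful[of a] that by (simp add: gram_def)
qed (simp_all add: expectation_add expectation_scaleC state_add state_scaleC)

lemma norm_embed_le: "norm (\<iota> a) \<le> norm a"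
  using norm_crossed_sum[OF finsupp_single[of \<one> a]] reduced_norm_single_one[of a]
  by (simp add: crossed_sum_single unitary_one)

lemma tendsto_embed:
  assumes "(f \<longlongrightarrow> x) F"
  shows "((\<lambda>i. \<iota> (f i)) \<longlongrightarrow> \<iota> x) F"
proof -
  have "bounded_linear \<iota>"
  proof (rule bounded_linear_intro[where K = 1])
    show "\<iota> (r *\<^sub>R a) = r *\<^sub>R \<iota> a" for r a by (simp add: embed_scaleC flip: scaleC_of_real)
  qed (use norm_embed_le in \<open>simp_all add: embed_add\<close>)
  then show ?thesis using assms by (rule bounded_linear.tendsto)
qed

end

section \<open>The filtration of the crossed product\<close>

lemma cspan_sesquilinear_zero:
  fixes \<phi> :: "'b::unital_cstar_algebra \<Rightarrow> complex"
  assumes \<phi>: "Vector_Spaces.linear scaleC (*) \<phi>"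
    and zero: "\<And>x y. x \<in> S \<Longrightarrow> y \<in> T \<Longrightarrow> \<phi> (star x * y) = 0"
    and xy: "x \<in> cspan S" "y \<in> cspan T"
  shows "\<phi> (star x * y) = 0"
proof -
  have add: "\<phi> (v + w) = \<phi> v + \<phi> w" and scale: "\<phi> (c *\<^sub>C v) = c * \<phi> v" for v w c
    using \<phi> by (simp_all add: cfunctional_iff)
  have \<phi>0: "\<phi> 0 = 0" using add[of 0 0] by simp
  have right: "\<phi> (star x * y) = 0" if "x \<in> S" for x
    using xy(2)
  proof (rule cvec.span_induct)
    show "cvec.subspace {y. \<phi> (star x * y) = 0}"
      by (simp add: cvec.subspace_def distrib_left mult_scaleC_right add scale \<phi>0)
  qed (use zero that in auto)
  show ?thesis
    using xy(1)
  proof (rule cvec.span_induct)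
    show "cvec.subspace {x. \<phi> (star x * y) = 0}"
      by (simp add: cvec.subspace_def star_add star_scaleC distrib_right mult_scaleC_left add scale \<phi>0)
  qed (rule right)
qed

lemma subspace_closure:
  fixes S :: "'b::unital_cstar_algebra set"
  assumes S: "cvec.subspace S"
  shows "cvec.subspace (closure S)"
  unfolding cvec.subspace_def
proof (intro conjI ballI allI)
  show "0 \<in> closure S"
    using cvec.subspace_0[OF S] closure_subset by blast
next
  fix x y assume "x \<in> closure S" "y \<in> closure S"
  then obtain d e where "\<forall>n. d n \<in> S" "d \<longlonglongrightarrow> x" "\<forall>n. e n \<in> S" "e \<longlonglongrightarrow> y"
    unfolding closure_sequential by blast
  then have "\<forall>n. d n + e n \<in> S" "(\<lambda>n. d n + e n) \<longlonglongrightarrow> x + y"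
    by (auto intro: cvec.subspace_add[OF S] tendsto_add)
  then show "x + y \<in> closure S"
    unfolding closure_sequential by (intro exI[of _ "\<lambda>n. d n + e n"] conjI)
next
  fix c x assume "x \<in> closure S"
  then obtain d where "\<forall>n. d n \<in> S" "d \<longlonglongrightarrow> x"
    unfolding closure_sequential by blast
  then have "\<forall>n. c *\<^sub>C d n \<in> S" "(\<lambda>n. c *\<^sub>C d n) \<longlonglongrightarrow> c *\<^sub>C x"
    by (auto intro: cvec.subspace_scale[OF S] tendsto_scaleC)
  then show "c *\<^sub>C x \<in> closure S"
    unfolding closure_sequential by (intro exI[of _ "\<lambda>n. c *\<^sub>C d n"] conjI)
qed

context reduced_crossed_system
begin

lemma state_expectation_generators:
  assumes "g \<in> carrier G" "h \<in> carrier G"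
  shows "\<tau> (expectation (star (\<iota> a * u g) * (\<iota> b * u h))) = (if g = h then \<tau> (star a * b) else 0)"
proof -
  have "star (\<iota> a * u g) * (\<iota> b * u h) = u (inv g) * \<iota> (star a * b) * u h"
    using assms by (simp add: star_mult star_unitary embed_mult embed_star mult.assoc)
  also have "\<dots> = \<iota> (\<beta> (inv g) (star a * b)) * u (inv g \<otimes> h)"
    using assms by (simp add: unitary_embed unitary_mult mult.assoc)
  finally have "expectation (star (\<iota> a * u g) * (\<iota> b * u h))
      = (if inv g \<otimes> h = \<one> then \<beta> (inv g) (star a * b) else 0)"
    using assms by (simp add: expectation_generator)
  moreover have "inv g \<otimes> h = \<one> \<longleftrightarrow> g = h"
    using assms by (rule inv_mult_eq_one)
  moreover have "\<tau> 0 = 0" using state_add[of 0 0] by simp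
  ultimately show ?thesis using assms by (simp add: invariant)
qed

lemma embed_unitary_in_cspan:
  assumes "a \<in> cspan F" and "\<And>b. b \<in> F \<Longrightarrow> \<iota> b * u g \<in> cspan T"
  shows "\<iota> a * u g \<in> cspan T"
  using assms(1)
proof (rule cvec.span_induct)
  show "cvec.subspace {a. \<iota> a * u g \<in> cspan T}"
    by (simp add: cvec.subspace_def embed_zero embed_add embed_scaleC distrib_right mult_scaleC_left
        cvec.span_zero cvec.span_add cvec.span_scale)
qed (rule assms(2))

lemma crossed_filtration_finite:
  assumes "finite F" "V i = cspan F" "finite {g \<in> carrier G. l g = j}"
  shows "\<exists>T. finite T \<and> crossed_filtration G l V \<iota> u (i, j) = cspan T"
proof (intro exI conjI)
  let ?T = "(\<lambda>(a, g). \<iota> a * u g) ` (F \<times> {g \<in> carrier G. l g = j})"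
  show "finite ?T" using assms by simp
  have "{\<iota> a * u g |a g. a \<in> V i \<and> g \<in> carrier G \<and> l g = j} \<subseteq> cspan ?T"
    unfolding assms(2)
  proof clarify
    fix a g assume a: "a \<in> cspan F" and g: "g \<in> carrier G" "j = l g"
    show "\<iota> a * u g \<in> cspan ((\<lambda>(a, g). \<iota> a * u g) ` (F \<times> {h \<in> carrier G. l h = l g}))"
      using a by (rule embed_unitary_in_cspan) (use g in \<open>auto intro!: cvec.span_base\<close>)
  qed
  moreover have "?T \<subseteq> {\<iota> a * u g |a g. a \<in> V i \<and> g \<in> carrier G \<and> l g = j}"
    unfolding assms(2) by (auto intro: cvec.span_base)
  ultimately show "crossed_filtration G l V \<iota> u (i, j) = cspan ?T"
    unfolding crossed_filtration_def prod.case
    by (intro antisym cvec.span_mono cvec.span_minimal cvec.subspace_span)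
qed

lemma crossed_filtration_zero:
  assumes "V i\<^sub>0 = range (\<lambda>c. c *\<^sub>C 1)" "\<And>g. g \<in> carrier G \<Longrightarrow> l g = 0 \<longleftrightarrow> g = \<one>"
  shows "crossed_filtration G l V \<iota> u (i\<^sub>0, 0) = range (\<lambda>c. c *\<^sub>C 1)"
proof -
  have "{\<iota> a * u g |a g. a \<in> V i\<^sub>0 \<and> g \<in> carrier G \<and> l g = 0} = {\<iota> a * u \<one> |a. a \<in> V i\<^sub>0}"
    using assms(2) by auto
  also have "\<dots> = range (\<lambda>c. c *\<^sub>C 1)"
  proof -
    have "\<iota> (c *\<^sub>C 1) * u \<one> = c *\<^sub>C 1" for c
      by (simp add: embed_scaleC embed_one unitary_one)
    then show ?thesis unfolding assms(1) by (auto simp: image_iff) metis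
  qed
  also have "\<dots> = cspan {1}"
    by (simp add: cvec.span_singleton)
  finally have generators: "{\<iota> a * u g |a g. a \<in> V i\<^sub>0 \<and> g \<in> carrier G \<and> l g = 0} = cspan {1}" .
  show ?thesis
    unfolding crossed_filtration_def prod.case generators cvec.span_span
    by (rule cvec.span_singleton)
qed

text \<open>
  A monomial \<open>\<iota> a * u g\<close> is a limit of elements \<open>\<iota> (d n) * u g\<close> with \<open>d n\<close> in the span of the
  filtration of \<open>A\<close>, because \<open>\<iota>\<close> is contractive; sums of monomials are dense.
\<close>

lemma crossed_filtration_dense:
  assumes "closure (cspan (\<Union>i. V i)) = UNIV"
  shows "closure (cspan (\<Union>k. crossed_filtration G l V \<iota> u k)) = UNIV"
proof -
  let ?S = "cspan (\<Union>k. crossed_filtration G l V \<iota> u k)"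
  have sub: "cvec.subspace (closure ?S)"
    by (intro subspace_closure cvec.subspace_span)
  have generator: "\<iota> a * u g \<in> closure ?S" if g: "g \<in> carrier G" for a g
  proof -
    obtain d where d: "\<And>n. d n \<in> cspan (\<Union>i. V i)" "d \<longlonglongrightarrow> a"
      using assms closure_sequential[of a "cspan (\<Union>i. V i)"] by auto
    have "\<iota> b * u g \<in> ?S" if "b \<in> (\<Union>i. V i)" for b
    proof -
      from that obtain i where "b \<in> V i" by blast
      then have "\<iota> b * u g \<in> crossed_filtration G l V \<iota> u (i, l g)"
        unfolding crossed_filtration_def using g by (auto intro: cvec.span_base)
      then show ?thesis by (intro cvec.span_base) blast
    qed
    then have "\<iota> (d n) * u g \<in> ?S" for n
      using d(1) by (rule embed_unitary_in_cspan[rotated])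
    moreover have "(\<lambda>n. \<iota> (d n) * u g) \<longlonglongrightarrow> \<iota> a * u g"
      by (intro tendsto_intros tendsto_embed d(2))
    ultimately show ?thesis
      unfolding closure_sequential by (intro exI[of _ "\<lambda>n. \<iota> (d n) * u g"]) simp
  qed
  have "algebraic \<subseteq> closure ?S"
    unfolding algebraic_def crossed_sum_def
    by (auto intro!: cvec.subspace_sum[OF sub] generator simp: gsupp_def)
  then have "closure algebraic \<subseteq> closure ?S"
    by (simp add: closure_minimal)
  then show ?thesis by (auto simp: closure_algebraic)
qed

lemma crossed_filtration_orthogonal:
  assumes orth: "\<And>i j a b. i \<noteq> j \<Longrightarrow> a \<in> V i \<Longrightarrow> b \<in> V j \<Longrightarrow> \<tau> (star a * b) = 0"
    and "p \<noteq> q" "x \<in> crossed_filtration G l V \<iota> u p" "y \<in> crossed_filtration G l V \<iota> u q"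
  shows "\<tau> (expectation (star x * y)) = 0"
proof -
  obtain i j i' j' where pq: "p = (i, j)" "q = (i', j')" by fastforce
  show ?thesis
  proof (rule cspan_sesquilinear_zero)
    show "Vector_Spaces.linear scaleC (*) (\<lambda>x. \<tau> (expectation x))"
      using faithful_state_expectation by (simp add: faithful_state_def)
    show "x \<in> cspan {\<iota> a * u g |a g. a \<in> V i \<and> g \<in> carrier G \<and> l g = j}"
      "y \<in> cspan {\<iota> a * u g |a g. a \<in> V i' \<and> g \<in> carrier G \<and> l g = j'}"
      using assms(3,4) by (simp_all add: crossed_filtration_def pq)
  next
    fix x y assume "x \<in> {\<iota> a * u g |a g. a \<in> V i \<and> g \<in> carrier G \<and> l g = j}"
      "y \<in> {\<iota> a * u g |a g. a \<in> V i' \<and> g \<in> carrier G \<and> l g = j'}"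
    then show "\<tau> (expectation (star x * y)) = 0"
      using assms(2) orth by (auto simp: pq state_expectation_generators)
  qed
qed

end

theorem proposition6p13:
  fixes \<tau>\<^sub>A :: "'a::unital_cstar_algebra \<Rightarrow> complex"
    and V :: "nat \<Rightarrow> 'a set"
    and G :: "('g, 'm) monoid_scheme"
    and l :: "'g \<Rightarrow> nat"
    and \<beta> :: "'g \<Rightarrow> 'a \<Rightarrow> 'a"
    and \<iota> :: "'a \<Rightarrow> 'b::unital_cstar_algebra"
    and u :: "'g \<Rightarrow> 'b"
  assumes "orthogonal_filtration \<tau>\<^sub>A 0 V"
    and "group G" and "finitely_generated G" and "proper_length G l"
    and "cstar_action G \<beta>"
    and "\<And>g a. g \<in> carrier G \<Longrightarrow> \<tau>\<^sub>A (\<beta> g a) = \<tau>\<^sub>A a"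
    and "reduced_crossed_product G \<beta> \<iota> u"
  shows "orthogonal_filtration (\<tau>\<^sub>A \<circ> canonical_expectation G \<iota> u) (0, 0)
           (crossed_filtration G l V \<iota> u)"
proof -
  note filtration = assms(1)[unfolded orthogonal_filtration_def]
  interpret reduced_crossed_system \<tau>\<^sub>A G \<beta> \<iota> u
    using filtration assms(2,5-7)
    by (intro reduced_crossed_system.intro cstar_dynamical_system.intro cstar_faithful_state.intro
        cstar_dynamical_system_axioms.intro reduced_crossed_system_axioms.intro) auto
  have state: "\<tau>\<^sub>A \<circ> canonical_expectation G \<iota> u = (\<lambda>x. \<tau>\<^sub>A (expectation x))"
    by (simp add: expectation_def fun_eq_iff)
  show ?thesis
    unfolding orthogonal_filtration_def state
  proof (intro conjI allI impI ballI)
    show "faithful_state (\<lambda>x. \<tau>\<^sub>A (expectation x))"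
      by (rule faithful_state_expectation)
  next
    fix k :: "nat \<times> nat"
    obtain F where "finite F" "V (fst k) = cspan F" using filtration by blast
    moreover have "finite {g \<in> carrier G. l g = snd k}"
      using assms(4) by (simp add: proper_length_def)
    ultimately show "\<exists>F. finite F \<and> crossed_filtration G l V \<iota> u k = cspan F"
      using crossed_filtration_finite[of F V "fst k" l "snd k"] by simp
  next
    show "crossed_filtration G l V \<iota> u (0, 0) = range (\<lambda>c. c *\<^sub>C 1)"
      using filtration assms(4) by (intro crossed_filtration_zero) (auto simp: proper_length_def)
  next
    show "closure (cspan (\<Union>k. crossed_filtration G l V \<iota> u k)) = UNIV"
      using filtration by (intro crossed_filtration_dense) auto
  next
    fix p q x y
    assume "p \<noteq> q" "x \<in> crossed_filtration G l V \<iota> u p" "y \<in> crossed_filtration G l V \<iota> u q"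
    then show "\<tau>\<^sub>A (expectation (star x * y)) = 0"
      using filtration by (intro crossed_filtration_orthogonal[of V p q x l y]) auto
  qed
qed

end
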